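(* Let $\mathfrak{F}$ be a formation and $\sigma(p)=\{q \mid (p,q)\in E(\Gamma_H(\mathfrak{F}))\}$. Then $\mathfrak{F}$ is recognized by $\Gamma_H$ if and only if $\mathfrak{F}=LF(f)$, where $f(p)=\mathfrak{G}_{\sigma(p)}$ for $p\in\pi(\mathfrak{F})$ and $f(p)=\emptyset$ otherwise.
   Context: All groups are finite; classes of groups are closed under isomorphism. $\pi(G)$ is the set of prime divisors of $|G|$ and $\pi(\mathfrak{F})=\bigcup_{G\in\mathfrak{F}}\pi(G)$. A formation is a class of groups $\mathfrak{F}$ closed under homomorphic images and such that $G/N_1,\dots,G/N_n\in\mathfrak{F}$ with $N_i\trianglelefteq G$ and $\bigcap_i N_i=1$ imply $G\in\mathfrak{F}$. Graphs are directed with loops allowed, and $E(\cdot)$ denotes the edge set; equality, inclusion and union are taken on vertex sets and edge sets. The Hawkes graph $\Gamma_H(G)$ has vertex set $\pi(G)$, and $(p,q)$ with $p,q\in\pi(G)$ is an edge if and only if $q\in\pi(G/\mathrm{O}_{p',p}(G))$; here $\mathrm{O}_{p',p}(G)$ is the largest normal $p$-nilpotent subgroup of $G$, and loops $(p,p)$ may occur. For a class $\mathfrak{F}$, $\Gamma_H(\mathfrak{F})=\bigcup_{G\in\mathfrak{F}}\Gamma_H(G)$. For a set $\pi$ of primes, $\mathfrak{G}_\pi$ is the class of all $\pi$-groups, with $\mathfrak{G}_\emptyset$ the class of unit (trivial) groups. For a function $f$ from primes to (possibly empty) formations, $LF(f)$ is the class of groups $G$ such that $G/C_G(H/K)\in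 f(p)$ for every chief factor $H/K$ of $G$ and every $p\in\pi(H/K)$. A class $\mathfrak{X}$ is recognized by a function $\Gamma$ from groups to graphs if $G_1\in\mathfrak{X}$ and $\Gamma(G_1)=\Gamma(G_2)$ imply $G_2\in\mathfrak{X}$.
   Formalization: The formation 𝔉 is assumed nonempty: the empty class is vacuously recognized by Γ_H, but then f(p)=∅ for every p and LF(f) is the class of trivial groups, so the equivalence fails for it. *)

theory Defs
  imports "HOL-Algebra.Algebra" "Graph_Theory.Pair_Digraph"
begin

definition finite_group :: "('a, 'b) monoid_scheme \<Rightarrow> bool" where
  "finite_group G \<longleftrightarrow> group G \<and> finite (carrier G)"

definition group_primes :: "('a, 'b) monoid_scheme \<Rightarrow> nat set" where
  "group_primes G = prime_factors (order G)"

section \<open>Classes of finite groups\<close>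

text \<open>
  A class of finite groups is represented by its members with carrier in \<^typ>\<open>nat\<close>.
  Since a class is closed under isomorphism and every finite group has an isomorphic copy
  on \<^typ>\<open>nat\<close> (lemma \<open>ex_nat_group\<close>), nothing is lost.  A group over another carrier
  type, typically a quotient, belongs to the class if it is isomorphic to a member.
\<close>

type_synonym group_class = "nat monoid set"

definition is_group_class :: "group_class \<Rightarrow> bool" where
  "is_group_class \<FF> \<longleftrightarrow>
     (\<forall>G\<in>\<FF>. finite_group G) \<and>
     (\<forall>G\<in>\<FF>. \<forall>H :: nat monoid. group H \<longrightarrow> G \<cong> H \<longrightarrow> H \<in> \<FF>)"

definition in_class :: "('a, 'b) monoid_scheme \<Rightarrow> group_class \<Rightarrow> bool" where
  "in_class G \<FF> \<longleftrightarrow> (\<exists>H\<in>\<FF>. H \<cong> G)"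

lemma ex_nat_group:
  assumes "finite_group G"
  shows "\<exists>H :: nat monoid. finite_group H \<and> G \<cong> H"
proof -
  interpret group G using assms by (simp add: finite_group_def)
  have fin: "finite (carrier G)" using assms by (simp add: finite_group_def)
  obtain f :: "'a \<Rightarrow> nat" where inj: "inj_on f (carrier G)"
    using finite_imp_inj_to_nat_seg[OF fin] by blast
  define g where "g = inv_into (carrier G) f"
  define H :: "nat monoid" where
    "H = \<lparr>carrier = f ` carrier G, monoid.mult = (\<lambda>x y. f (g x \<otimes>\<^bsub>G\<^esub> g y)), one = f \<one>\<^bsub>G\<^esub>\<rparr>"
  have gf: "g (f x) = x" if "x \<in> carrier G" for x
    using that inj by (simp add: g_def)
  have iso: "f \<in> iso G H"
    using inj by (auto simp: iso_def hom_def bij_betw_def H_def gf)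
  have "Group.monoid H"
    by (rule monoidI) (auto simp: H_def gf m_assoc)
  then have "group (H\<lparr>one := f \<one>\<^bsub>G\<^esub>\<rparr>)"
    using iso_imp_group is_isoI[OF iso] by (simp add: H_def)
  then have "group H" by (simp add: H_def)
  moreover have "finite (carrier H)" using fin by (simp add: H_def)
  ultimately show ?thesis using is_isoI[OF iso] by (auto simp: finite_group_def)
qed

lemma in_class_iff:
  assumes "is_group_class \<FF>" "group G"
  shows "in_class (G :: nat monoid) \<FF> \<longleftrightarrow> G \<in> \<FF>"
  using assms iso_refl unfolding in_class_def is_group_class_def by blast

definition class_primes :: "group_class \<Rightarrow> nat set" where
  "class_primes \<FF> = (\<Union>G\<in>\<FF>. group_primes G)"

text \<open>
  The empty class is a formation here, because the number of normal subgroups in the second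
  closure property is positive.
\<close>

definition formation :: "group_class \<Rightarrow> bool" where
  "formation \<FF> \<longleftrightarrow>
     is_group_class \<FF> \<and>
     (\<forall>G\<in>\<FF>. \<forall>H :: nat monoid. group H \<longrightarrow> epi G H \<noteq> {} \<longrightarrow> H \<in> \<FF>) \<and>
     (\<forall>G :: nat monoid. \<forall>\<N>.
        finite_group G \<longrightarrow> finite \<N> \<longrightarrow> \<N> \<noteq> {} \<longrightarrow>
        (\<forall>N\<in>\<N>. N \<lhd> G \<and> in_class (G Mod N) \<FF>) \<longrightarrow> \<Inter>\<N> = {\<one>\<^bsub>G\<^esub>} \<longrightarrow> G \<in> \<FF>)"

definition pi_groups :: "nat set \<Rightarrow> group_class" where
  "pi_groups \<pi> = {G. finite_group G \<and> group_primes G \<subseteq> \<pi>}"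

definition recognized_by :: "group_class \<Rightarrow> (nat monoid \<Rightarrow> 'g) \<Rightarrow> bool" where
  "recognized_by \<XX> \<Gamma> \<longleftrightarrow>
     (\<forall>G\<^sub>1 G\<^sub>2. finite_group G\<^sub>1 \<longrightarrow> finite_group G\<^sub>2 \<longrightarrow>
        G\<^sub>1 \<in> \<XX> \<longrightarrow> \<Gamma> G\<^sub>1 = \<Gamma> G\<^sub>2 \<longrightarrow> G\<^sub>2 \<in> \<XX>)"

section \<open>Local formations\<close>

definition chief_factor :: "('a, 'b) monoid_scheme \<Rightarrow> 'a set \<Rightarrow> 'a set \<Rightarrow> bool" where
  "chief_factor G H K \<longleftrightarrow>
     H \<lhd> G \<and> K \<lhd> G \<and> K \<subset> H \<and> \<not> (\<exists>L. L \<lhd> G \<and> K \<subset> L \<and> L \<subset> H)"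

text \<open>The elements of \<open>G\<close> whose conjugation action on \<open>H/K\<close> is trivial.\<close>

definition centralizer_factor :: "('a, 'b) monoid_scheme \<Rightarrow> 'a set \<Rightarrow> 'a set \<Rightarrow> 'a set" where
  "centralizer_factor G H K =
     {g \<in> carrier G. \<forall>h\<in>H. K #>\<^bsub>G\<^esub> (g \<otimes>\<^bsub>G\<^esub> h \<otimes>\<^bsub>G\<^esub> inv\<^bsub>G\<^esub> g) = K #>\<^bsub>G\<^esub> h}"

definition LF :: "(nat \<Rightarrow> group_class) \<Rightarrow> group_class" where
  "LF f = {G. finite_group G \<and>
     (\<forall>H K. chief_factor G H K \<longrightarrow>
        (\<forall>p \<in> group_primes (G\<lparr>carrier := H\<rparr> Mod K).
           in_class (G Mod centralizer_factor G H K) (f p)))}"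

section \<open>The Hawkes graph\<close>

text \<open>A group is \<open>p\<close>-nilpotent if it has a normal \<open>p\<close>-complement.\<close>

definition p_nilpotent :: "nat \<Rightarrow> ('a, 'b) monoid_scheme \<Rightarrow> bool" where
  "p_nilpotent p G \<longleftrightarrow>
     (\<exists>N. N \<lhd> G \<and> \<not> p dvd card N \<and> (\<exists>k. order (G Mod N) = p ^ k))"

definition O_p'_p :: "nat \<Rightarrow> ('a, 'b) monoid_scheme \<Rightarrow> 'a set" where
  "O_p'_p p G = (GREATEST M. M \<lhd> G \<and> p_nilpotent p (G\<lparr>carrier := M\<rparr>))"

definition hawkes_graph :: "('a, 'b) monoid_scheme \<Rightarrow> nat pair_pre_digraph" where
  "hawkes_graph G =
     \<lparr>pverts = group_primes G,
      parcs = {(p, q). p \<in> group_primes G \<and> q \<in> group_primes G \<and>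
                       q \<in> group_primes (G Mod O_p'_p p G)}\<rparr>"

definition class_hawkes_graph :: "group_class \<Rightarrow> nat pair_pre_digraph" where
  "class_hawkes_graph \<FF> =
     \<lparr>pverts = (\<Union>G\<in>\<FF>. pverts (hawkes_graph G)),
      parcs = (\<Union>G\<in>\<FF>. parcs (hawkes_graph G))\<rparr>"

end

theory Submission
  imports Defs
begin

text \<open>
  Write \<open>O(G)\<close> for \<open>O_p'_p p G\<close> and \<open>\<Gamma>\<close> for the Hawkes graph.  The key fact is that \<open>O(G)\<close> is the
  intersection of the centralizers of all chief factors of \<open>G\<close> whose order is divisible by \<open>p\<close>
  (\<open>O_p'_p_eq_Inter\<close>).  It has two halves.

  A normal \<open>p\<close>-nilpotent subgroup \<open>M\<close> centralizes every such factor \<open>H/K\<close>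
  (\<open>p_nilpotent_subset_centralizer_factor\<close>).  After passing to \<open>G/K\<close>, \<open>H\<close> is minimal normal, so the
  normal \<open>p\<close>-complement \<open>N\<close> of \<open>M\<close> meets \<open>H\<close> trivially and therefore centralizes it, and the
  \<open>p\<close>-group \<open>M/N\<close>, acting on a set of order divisible by \<open>p\<close> and fixing \<open>1\<close>, has a further fixed
  point in \<open>H\<close>; the fixed points form a normal subgroup of \<open>G\<close>, hence all of \<open>H\<close>.

  Conversely, a normal subgroup \<open>M\<close> centralizing all these factors is \<open>p\<close>-nilpotent
  (\<open>p_nilpotent_if_central\<close>).  One descends along a chief series, keeping a normal subgroup \<open>L\<close>
  between the current term \<open>H\<close> and \<open>M\<close> such that \<open>L/H\<close> is a \<open>p'\<close>-group and \<open>M/L\<close> a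
  \<open>p\<close>-group.  A factor \<open>H/K\<close> of order prime to \<open>p\<close> leaves \<open>L\<close> unchanged; otherwise \<open>H/K\<close> is a
  central \<open>p\<close>-subgroup of \<open>L/K\<close>, and the transfer homomorphism \<open>L/K \<rightarrow> H/K\<close> has as kernel a
  characteristic complement, which replaces \<open>L\<close>.

  As a consequence, a finite group \<open>G\<close> lies in \<open>LF f\<close>, for the function \<open>f\<close> of the theorem, if and
  only if \<open>\<Gamma>(G)\<close> is a subgraph of \<open>\<Gamma>(\<FF>)\<close> (\<open>in_LF_iff_hawkes_graph_subset\<close>).  So \<open>\<FF> \<subseteq> LF f\<close> always
  holds, and \<open>LF f\<close> is recognized by \<open>\<Gamma>\<close>, because membership depends on the graph only.

  For the other direction let \<open>\<FF>\<close> be recognized and \<open>G \<in> LF f\<close>.  Since \<open>O(A \<times> B) = O(A) \<times> O(B)\<close>, the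
  graph of \<open>A \<times> B\<close> is the union of the graphs of \<open>A\<close> and \<open>B\<close>, so some finite direct product
  \<open>A \<in> \<FF>\<close> of members satisfies \<open>\<Gamma>(G) \<subseteq> \<Gamma>(A)\<close>.  Then \<open>\<Gamma>(A \<times> G) = \<Gamma>(A)\<close>, whence \<open>A \<times> G \<in> \<FF>\<close>, and
  \<open>G\<close> belongs to \<open>\<FF>\<close> as a quotient of \<open>A \<times> G\<close>.
\<close>

section \<open>Counting in subgroups and quotients\<close>

(* From here on, prime is primality of numbers, not of elements of a monoid. *)
hide_const (open) Divisibility.prime

lemma in_group_primes_iff:
  assumes "finite_group G"
  shows "q \<in> group_primes G \<longleftrightarrow> prime q \<and> q dvd order G"
proof -
  have "order G \<noteq> 0"
    using assms group.is_monoid[of G] monoid.order_gt_0_iff_finite[of G]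
    by (simp add: finite_group_def)
  then show ?thesis by (simp add: group_primes_def prime_factors_dvd)
qed

text \<open>
  All fibres of a homomorphism restricted to \<open>A\<close> are translates of the one over the neutral
  element.  Where only orders matter, this stands in for the isomorphism theorems.
\<close>

lemma (in group_hom) card_image_mult_card_fibre:
  assumes A: "subgroup A G" and fin: "finite A"
  shows "card A = card (h ` A) * card {x \<in> A. h x = \<one>\<^bsub>H\<^esub>}"
proof -
  interpret A: subgroup A G by fact
  have "card {x \<in> A. h x = y} = card {x \<in> A. h x = \<one>\<^bsub>H\<^esub>}" if "y \<in> h ` A" for y
  proof -
    from that obtain a where a: "y = h a" "a \<in> A" ..
    have "bij_betw (\<lambda>x. a \<otimes> x) {x \<in> A. h x = \<one>\<^bsub>H\<^esub>} {x \<in> A. h x = y}"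
    proof (rule bij_betwI[where g = "\<lambda>x. inv a \<otimes> x"])
      show "(\<lambda>x. a \<otimes> x) \<in> {x \<in> A. h x = \<one>\<^bsub>H\<^esub>} \<rightarrow> {x \<in> A. h x = y}"
        using a A.mem_carrier A.m_closed by (simp add: Pi_iff)
      show "(\<lambda>x. inv a \<otimes> x) \<in> {x \<in> A. h x = y} \<rightarrow> {x \<in> A. h x = \<one>\<^bsub>H\<^esub>}"
        using a A.mem_carrier A.m_closed A.m_inv_closed by (simp add: Pi_iff)
    next
      fix x assume "x \<in> {x \<in> A. h x = \<one>\<^bsub>H\<^esub>}"
      then show "inv a \<otimes> (a \<otimes> x) = x"
        using a by (simp flip: G.m_assoc)
    next
      fix x assume "x \<in> {x \<in> A. h x = y}"
      then show "a \<otimes> (inv a \<otimes> x) = x"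
        using a by (simp flip: G.m_assoc)
    qed
    then show ?thesis by (simp add: bij_betw_same_card)
  qed
  moreover have "card A = (\<Sum>y\<in>h ` A. card {x \<in> A. h x = y})"
    using sum.image_gen[OF fin, of "\<lambda>_. 1::nat" h] by simp
  ultimately show ?thesis by simp
qed

lemma (in normal) hom_Mod: "group_hom G (G Mod H) (\<lambda>x. H #> x)"
  using r_coset_hom_Mod factorgroup_is_group
  by (simp add: group_hom_def group_hom_axioms_def)

lemma (in normal) rcos_eq_self_iff: "x \<in> carrier G \<Longrightarrow> H #> x = H \<longleftrightarrow> x \<in> H"
  using coset_join1 coset_join2 is_subgroup by (metis subset)

lemma (in normal) card_quotient:
  assumes "subgroup A G" "H \<subseteq> A" "finite A"
  shows "card A = card ((\<lambda>x. H #> x) ` A) * card H"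
proof -
  interpret q: group_hom G "G Mod H" "\<lambda>x. H #> x" by (rule hom_Mod)
  have "{x \<in> A. H #> x = \<one>\<^bsub>G Mod H\<^esub>} = H"
    using assms rcos_eq_self_iff subgroup.subset[OF assms(1)] by auto
  then show ?thesis using q.card_image_mult_card_fibre[OF assms(1,3)] by simp
qed

lemma card_normal_pos:
  assumes "finite_group G" "N \<lhd> G"
  shows "card N > 0"
  using subgroup.finite_imp_card_positive[OF normal_imp_subgroup[OF assms(2)]] assms(1)
  by (simp add: finite_group_def)

lemma finite_group_Mod:
  assumes "finite_group G" "N \<lhd> G"
  shows "finite_group (G Mod N)" and "order G = order (G Mod N) * card N"
proof -
  interpret normal N G by fact
  show "finite_group (G Mod N)"
    using assms factorgroup_is_group by (simp add: finite_group_def carrier_FactGroup)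
  show "order G = order (G Mod N) * card N"
    using lagrange[OF is_subgroup] by (simp add: FactGroup_def order_def)
qed

lemma finite_group_Mod_restrict:
  assumes "finite_group G" "H \<lhd> G" "K \<lhd> G" "K \<subseteq> H"
  shows "finite_group (G\<lparr>carrier := H\<rparr> Mod K)"
    and "card H = order (G\<lparr>carrier := H\<rparr> Mod K) * card K"
proof -
  interpret group G using assms by (simp add: finite_group_def)
  have H: "subgroup H G" using assms normal_imp_subgroup by blast
  then have "finite_group (G\<lparr>carrier := H\<rparr>)"
    using assms subgroup.subset[OF H] finite_subset subgroup_imp_group
    by (auto simp: finite_group_def)
  moreover have "K \<lhd> G\<lparr>carrier := H\<rparr>"
    using assms H normal_restrict_supergroup by blast
  ultimately show "finite_group (G\<lparr>carrier := H\<rparr> Mod K)"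
      "card H = order (G\<lparr>carrier := H\<rparr> Mod K) * card K"
    using finite_group_Mod[of "G\<lparr>carrier := H\<rparr>" K] by (auto simp: order_def)
qed

lemma (in group) normal_carrier: "carrier G \<lhd> G"
  using subgroup_self by (simp add: normal_inv_iff)

lemma (in group_hom) normal_vimage:
  assumes "N \<lhd> H"
  shows "{x \<in> carrier G. h x \<in> N} \<lhd> G"
proof -
  interpret N: normal N H by fact
  show ?thesis
    unfolding G.normal_inv_iff
  proof (intro conjI ballI)
    show "subgroup {x \<in> carrier G. h x \<in> N} G"
      by (rule G.subgroupI) (auto intro!: exI[of _ "\<one>"])
  qed (auto simp: N.inv_op_closed2)
qed

lemma (in group) coprime_pow_imp_one:
  assumes "x \<in> carrier G" "x [^] (a::nat) = \<one>" "x [^] (b::nat) = \<one>" "coprime a b"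
  shows "x = \<one>"
  using assms by (metis pow_eq_id coprime_common_divisor_nat ord_eq_1)

lemma (in group) subgroup_pow_card:
  assumes "subgroup A G" "x \<in> A"
  shows "x [^] card A = \<one>"
proof -
  interpret A: group "G\<lparr>carrier := A\<rparr>" using assms subgroup_imp_group by blast
  show ?thesis using A.pow_order_eq_1 assms nat_pow_consistent by (simp add: order_def)
qed

text \<open>
  The weak form of Cauchy's theorem that a nontrivial Sylow \<open>p\<close>-subgroup provides.
\<close>

lemma (in group) p_elementE:
  assumes "subgroup A G" "finite A" "prime p" "p dvd card A"
  obtains x k where "x \<in> A" "x \<noteq> \<one>" "x [^] (p ^ k :: nat) = \<one>"
proof -
  interpret A: group "G\<lparr>carrier := A\<rparr>" using assms subgroup_imp_group by blast
  have A0: "card A \<noteq> 0" using subgroup.one_closed[OF assms(1)] assms(2) card_0_eq by (metis emptyE)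
  obtain k m where km: "card A = p ^ k * m" "\<not> p dvd m"
    using multiplicity_decompose'[of "card A" p] assms A0 not_prime_unit by metis
  obtain P where P: "subgroup P (G\<lparr>carrier := A\<rparr>)" "card P = p ^ k"
    using sylow_thm[of p "G\<lparr>carrier := A\<rparr>" k m] assms km A.group_axioms by (auto simp: order_def)
  have "k > 0" using km assms by (cases k) auto
  then have "card P > 1" using P(2) assms(3) by (metis one_less_power prime_gt_1_nat)
  then have "\<not> P \<subseteq> {\<one>}" using card_mono[of "{\<one>}" P] by auto
  then obtain x where "x \<in> P" "x \<noteq> \<one>" by auto
  moreover have "subgroup P G" "P \<subseteq> A"
    using incl_subgroup[OF assms(1) P(1)] subgroup.subset[OF P(1)] by simp_all
  ultimately show ?thesis using that[of x k] subgroup_pow_card P by (metis subsetD)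
qed

lemma (in group) card_subgroup_dvd:
  assumes "subgroup A G" "subgroup B G" "A \<subseteq> B"
  shows "card A dvd card B"
proof -
  interpret B: group "G\<lparr>carrier := B\<rparr>" using assms subgroup_imp_group by simp
  have "subgroup A (G\<lparr>carrier := B\<rparr>)" using assms subgroup_incl by simp
  from B.lagrange[OF this] show ?thesis by (simp add: order_def) (metis dvd_triv_right)
qed

lemma (in group) conj_pow:
  assumes "g \<in> carrier G" "x \<in> carrier G"
  shows "(g \<otimes> x \<otimes> inv g) [^] (n::nat) = g \<otimes> x [^] n \<otimes> inv g"
proof (induction n)
  case (Suc n)
  have "inv g \<otimes> (g \<otimes> (x \<otimes> inv g)) = x \<otimes> inv g"
    using assms by (simp flip: m_assoc)
  then show ?case using assms Suc by (simp add: m_assoc)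
qed (use assms in simp)

section \<open>Centralizers and chief factors\<close>

definition centralizer :: "('a, 'b) monoid_scheme \<Rightarrow> 'a set \<Rightarrow> 'a set" where
  "centralizer G A = {g \<in> carrier G. \<forall>a\<in>A. g \<otimes>\<^bsub>G\<^esub> a = a \<otimes>\<^bsub>G\<^esub> g}"

lemma (in group) conj_eq_self_iff:
  assumes "g \<in> carrier G" "x \<in> carrier G"
  shows "g \<otimes> x \<otimes> inv g = x \<longleftrightarrow> g \<otimes> x = x \<otimes> g"
  using assms by (metis inv_solve_right m_closed)

lemma (in group) subgroup_centralizer:
  assumes "A \<subseteq> carrier G"
  shows "subgroup (centralizer G A) G"
proof (rule subgroupI)
  show "centralizer G A \<subseteq> carrier G" by (auto simp: centralizer_def)
  show "centralizer G A \<noteq> {}" using assms by (auto simp: centralizer_def intro!: exI[of _ \<one>])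
next
  fix a assume a: "a \<in> centralizer G A"
  have "inv a \<otimes> x = x \<otimes> inv a" if "x \<in> A" for x
  proof -
    have x: "x \<in> carrier G" "a \<in> carrier G" "a \<otimes> x = x \<otimes> a"
      using that a assms by (auto simp: centralizer_def)
    then have "inv a \<otimes> (a \<otimes> x) \<otimes> inv a = inv a \<otimes> (x \<otimes> a) \<otimes> inv a" by simp
    then show ?thesis using x by (metis inv_closed inv_solve_left inv_solve_right m_assoc m_closed)
  qed
  then show "inv a \<in> centralizer G A" using a by (simp add: centralizer_def)
next
  fix a b assume ab: "a \<in> centralizer G A" "b \<in> centralizer G A"
  have "a \<otimes> b \<otimes> x = x \<otimes> (a \<otimes> b)" if "x \<in> A" for x
  proof -
    have x: "x \<in> carrier G" "a \<in> carrier G" "a \<otimes> x = x \<otimes> a" "b \<in> carrier G" "b \<otimes> x = x \<otimes> b"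
      using that ab assms by (auto simp: centralizer_def)
    then show ?thesis by (metis m_assoc)
  qed
  then show "a \<otimes> b \<in> centralizer G A" using ab by (simp add: centralizer_def)
qed

lemma (in group) normal_centralizer:
  assumes "A \<lhd> G"
  shows "centralizer G A \<lhd> G"
proof -
  interpret A: normal A G by fact
  have "g \<otimes> c \<otimes> inv g \<in> centralizer G A" if g: "g \<in> carrier G" and c: "c \<in> centralizer G A" for g c
  proof -
    have cc: "c \<in> carrier G" using c by (simp add: centralizer_def)
    have "(g \<otimes> c \<otimes> inv g) \<otimes> a = a \<otimes> (g \<otimes> c \<otimes> inv g)" if a: "a \<in> A" for a
    proof -
      have ac: "a \<in> carrier G" using a by simp
      have "inv g \<otimes> a \<otimes> g \<in> A" using A.inv_op_closed1 g a by simp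
      then have *: "c \<otimes> (inv g \<otimes> a \<otimes> g) = (inv g \<otimes> a \<otimes> g) \<otimes> c"
        using c by (simp add: centralizer_def)
      have "(g \<otimes> c \<otimes> inv g) \<otimes> a = g \<otimes> (c \<otimes> (inv g \<otimes> a \<otimes> g)) \<otimes> inv g"
        using g cc ac by (simp add: m_assoc)
      also have "\<dots> = a \<otimes> (g \<otimes> c \<otimes> inv g)"
        unfolding * using g cc ac by (simp add: m_assoc[symmetric])
      finally show ?thesis .
    qed
    then show ?thesis using g cc by (simp add: centralizer_def)
  qed
  then show ?thesis using subgroup_centralizer[OF A.subset] by (simp add: normal_inv_iff)
qed

text \<open>
  Acting trivially on \<open>H/K\<close> means commuting with it in \<open>G/K\<close>; this reduces statements about chief
  factors to minimal normal subgroups.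
\<close>

lemma (in group) centralizer_factor_eq_vimage:
  assumes "K \<lhd> G" "H \<subseteq> carrier G"
  shows "centralizer_factor G H K =
    {g \<in> carrier G. K #> g \<in> centralizer (G Mod K) ((\<lambda>x. K #> x) ` H)}"
proof -
  interpret K: normal K G by fact
  interpret q: group_hom G "G Mod K" "\<lambda>x. K #> x" by (rule K.hom_Mod)
  have "K #> (g \<otimes> h \<otimes> inv g) = K #> h \<longleftrightarrow>
      (K #> g) \<otimes>\<^bsub>G Mod K\<^esub> (K #> h) = (K #> h) \<otimes>\<^bsub>G Mod K\<^esub> (K #> g)"
    if "g \<in> carrier G" "h \<in> H" for g h
  proof -
    have h: "h \<in> carrier G" using that assms by auto
    have "K #> (g \<otimes> h \<otimes> inv g) =
        (K #> g) \<otimes>\<^bsub>G Mod K\<^esub> (K #> h) \<otimes>\<^bsub>G Mod K\<^esub> inv\<^bsub>G Mod K\<^esub> (K #> g)"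
      using that h q.hom_mult q.hom_inv by (metis inv_closed m_closed)
    then show ?thesis
      using that h q.H.conj_eq_self_iff[OF q.hom_closed q.hom_closed] by simp
  qed
  then show ?thesis
    using q.hom_closed unfolding centralizer_factor_def centralizer_def by auto
qed

lemma (in group) normal_centralizer_factor:
  assumes "H \<lhd> G" "K \<lhd> G"
  shows "centralizer_factor G H K \<lhd> G"
proof -
  interpret K: normal K G by fact
  interpret q: group_hom G "G Mod K" "\<lambda>x. K #> x" by (rule K.hom_Mod)
  have "(\<lambda>x. K #> x) ` H \<lhd> G Mod K"
    using normal.surj_hom_normal_subgroup[OF assms(1) K.hom_Mod] by (simp add: carrier_FactGroup)
  then show ?thesis
    using q.normal_vimage q.H.normal_centralizer
      centralizer_factor_eq_vimage[OF assms(2) subgroup.subset[OF normal_imp_subgroup[OF assms(1)]]]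
    by simp
qed

lemma (in group_hom) vimage_image_eq:
  assumes "kernel G H h \<subseteq> L" "subgroup L G"
  shows "{x \<in> carrier G. h x \<in> h ` L} = L"
proof
  interpret L: subgroup L G by fact
  show "L \<subseteq> {x \<in> carrier G. h x \<in> h ` L}" using L.subset by auto
  show "{x \<in> carrier G. h x \<in> h ` L} \<subseteq> L"
  proof
    fix x assume "x \<in> {x \<in> carrier G. h x \<in> h ` L}"
    then obtain b where b: "x \<in> carrier G" "b \<in> L" "h x = h b" by auto
    then have "x \<otimes> inv b \<in> L" using assms(1) by (auto simp: kernel_def subset_iff)
    then have "x \<otimes> inv b \<otimes> b \<in> L" using b by simp
    then show "x \<in> L" using b by (simp add: G.m_assoc)
  qed
qed

text \<open>
  By the correspondence theorem a chief factor over the kernel becomes a minimal normal subgroup,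
  encoded as a chief factor over the trivial subgroup.
\<close>

lemma (in group_hom) chief_factor_image:
  assumes surj: "h ` carrier G = carrier H" and chief: "chief_factor G A (kernel G H h)"
  shows "chief_factor H (h ` A) {\<one>\<^bsub>H\<^esub>}"
proof -
  let ?K = "kernel G H h"
  have A: "A \<lhd> G" and KA: "?K \<subset> A"
    and min: "\<And>L. L \<lhd> G \<Longrightarrow> ?K \<subseteq> L \<Longrightarrow> L \<subseteq> A \<Longrightarrow> L = ?K \<or> L = A"
    using chief by (auto simp: chief_factor_def)
  interpret A: normal A G by fact
  have img: "h ` A \<lhd> H"
    using A.surj_hom_normal_subgroup[OF group_hom_axioms surj] .
  obtain a where a: "a \<in> A" "a \<notin> ?K" using KA by auto
  then have a1: "h a \<noteq> \<one>\<^bsub>H\<^esub>" by (simp add: kernel_def)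
  have "\<one>\<^bsub>H\<^esub> \<in> h ` A" using A.one_closed hom_one by (metis imageI)
  then have "{\<one>\<^bsub>H\<^esub>} \<subset> h ` A" using a a1 by auto
  moreover have False if L: "L \<lhd> H" "{\<one>\<^bsub>H\<^esub>} \<subset> L" "L \<subset> h ` A" for L
  proof -
    let ?L = "{x \<in> carrier G. h x \<in> L}"
    have "?L \<subseteq> {x \<in> carrier G. h x \<in> h ` A}" using L(3) by auto
    then have "?L \<subseteq> A"
      using vimage_image_eq[OF psubset_imp_subset[OF KA] A.is_subgroup] by simp
    moreover have "?L \<lhd> G" using normal_vimage[OF L(1)] .
    moreover have "?K \<subseteq> ?L" using L(2) by (auto simp: kernel_def)
    ultimately have "?L = ?K \<or> ?L = A" using min by simp
    moreover have "h ` ?L = L" using L(3) A.subset by auto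
    moreover have "h ` ?K \<subseteq> {\<one>\<^bsub>H\<^esub>}" by (auto simp: kernel_def)
    ultimately show False using L by auto
  qed
  ultimately show ?thesis using img H.one_is_normal unfolding chief_factor_def by metis
qed

lemma (in normal) kernel_Mod: "kernel G (G Mod H) (\<lambda>x. H #> x) = H"
  using rcos_eq_self_iff subset unfolding kernel_def by auto

lemma (in group) chief_factor_Mod:
  assumes "chief_factor G H K"
  shows "chief_factor (G Mod K) ((\<lambda>x. K #> x) ` H) {\<one>\<^bsub>G Mod K\<^esub>}"
proof -
  interpret K: normal K G using assms by (simp add: chief_factor_def)
  show ?thesis
    using group_hom.chief_factor_image[OF K.hom_Mod] assms
    by (simp add: K.kernel_Mod carrier_FactGroup)
qed

section \<open>Normal p-nilpotent subgroups\<close>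

text \<open>
  A normal \<open>p\<close>-complement \<open>N\<close> of \<open>M\<close> that is normal even in the overgroup \<open>G\<close>, with the condition on
  the index written multiplicatively so that no quotient type is involved.
\<close>

definition normal_p_complement ::
  "nat \<Rightarrow> ('a, 'b) monoid_scheme \<Rightarrow> 'a set \<Rightarrow> 'a set \<Rightarrow> bool" where
  "normal_p_complement p G M N \<longleftrightarrow>
     N \<lhd> G \<and> N \<subseteq> M \<and> \<not> p dvd card N \<and> (\<exists>k. card M = card N * p ^ k)"

lemma finite_group_restrict:
  assumes "finite_group G" "subgroup M G"
  shows "finite_group (G\<lparr>carrier := M\<rparr>)"
  using assms subgroup.subset[OF assms(2)] finite_subset group.subgroup_imp_group
  by (auto simp: finite_group_def)

text \<open>
  An element killed by \<open>card N\<close> has an image in \<open>G/N\<close> whose order is both a power of \<open>p\<close> and prime to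
  \<open>p\<close>.  The description of \<open>N\<close> by a power equation shows that \<open>N\<close> is characteristic.
\<close>

lemma normal_p_complement_eq:
  fixes G (structure)
  assumes "finite_group G" "prime p" "N \<lhd> G" "\<not> p dvd card N" "order (G Mod N) = p ^ k"
  shows "N = {x \<in> carrier G. x [^]\<^bsub>G\<^esub> card N = \<one>\<^bsub>G\<^esub>}"
proof -
  interpret normal N G by fact
  interpret q: group_hom G "G Mod N" "\<lambda>x. N #> x" by (rule hom_Mod)
  have "x \<in> N" if "x \<in> carrier G" "x [^] card N = \<one>" for x
  proof -
    have "(N #> x) [^]\<^bsub>G Mod N\<^esub> card N = \<one>\<^bsub>G Mod N\<^esub>"
      using that q.hom_nat_pow[OF that(1), of "card N"] q.hom_one by simp
    moreover have "(N #> x) [^]\<^bsub>G Mod N\<^esub> (p ^ k) = \<one>\<^bsub>G Mod N\<^esub>"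
      using q.H.pow_order_eq_1[OF q.hom_closed[OF that(1)]] assms(5) by simp
    moreover have "coprime (card N) (p ^ k)"
      using assms by (metis coprime_commute coprime_power_right_iff prime_imp_coprime)
    ultimately have "N #> x = \<one>\<^bsub>G Mod N\<^esub>"
      using q.H.coprime_pow_imp_one[OF q.hom_closed[OF that(1)]] by simp
    then show ?thesis using rcos_eq_self_iff that by simp
  qed
  moreover have "x [^] card N = \<one>" if "x \<in> N" for x
    using subgroup_pow_card[OF is_subgroup that] .
  ultimately show ?thesis using subset by auto
qed

text \<open>
  A normal \<open>p\<close>-complement of \<open>M\<close> is the solution set of a power equation in \<open>M\<close>, and conjugation by
  elements of \<open>G\<close> preserves such a set.
\<close>

lemma p_nilpotent_iff_normal_p_complement:
  fixes G (structure)
  assumes G: "finite_group G" and p: "prime p" and M: "M \<lhd> G"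
  shows "p_nilpotent p (G\<lparr>carrier := M\<rparr>) \<longleftrightarrow> (\<exists>N. normal_p_complement p G M N)"
proof -
  interpret M: normal M G by fact
  let ?M = "G\<lparr>carrier := M\<rparr>"
  have fM: "finite_group ?M" using finite_group_restrict[OF G M.is_subgroup] .
  show ?thesis
  proof
    assume "p_nilpotent p ?M"
    then obtain N k where N: "N \<lhd> ?M" "\<not> p dvd card N" "order (?M Mod N) = p ^ k"
      by (auto simp: p_nilpotent_def)
    have N_eq: "N = {x \<in> M. x [^] card N = \<one>}"
      using normal_p_complement_eq[OF fM p N] M.nat_pow_consistent by simp
    have sub: "subgroup N G" using M.incl_subgroup[OF M.is_subgroup normal_imp_subgroup[OF N(1)]] .
    have "g \<otimes> x \<otimes> inv g \<in> N" if g: "g \<in> carrier G" and x: "x \<in> N" for g x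
    proof -
      have x': "x \<in> M" "x [^] card N = \<one>" using x N_eq by auto
      then have "(g \<otimes> x \<otimes> inv g) [^] card N = \<one>" using M.conj_pow g by simp
      then show ?thesis
        using M.inv_op_closed2[OF g x'(1)] by (subst N_eq) simp
    qed
    then have "N \<lhd> G" using sub by (simp add: M.normal_inv_iff)
    moreover have "N \<subseteq> M" using N_eq by auto
    moreover have "card M = card N * p ^ k"
      using finite_group_Mod(2)[OF fM N(1)] N(3) by (simp add: order_def)
    ultimately show "\<exists>N. normal_p_complement p G M N"
      using N(2) unfolding normal_p_complement_def by metis
  next
    assume "\<exists>N. normal_p_complement p G M N"
    then obtain N k where N: "N \<lhd> G" "N \<subseteq> M" "\<not> p dvd card N" "card M = card N * p ^ k"
      by (auto simp: normal_p_complement_def)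
    have NM: "N \<lhd> ?M" using M.normal_restrict_supergroup[OF M.is_subgroup N(1,2)] .
    have "card N > 0"
      using N(3) by (metis dvd_0_right gr0I)
    then have "order (?M Mod N) = p ^ k"
      using finite_group_Mod(2)[OF fM NM] N(4) by (simp add: order_def)
    then show "p_nilpotent p ?M" using NM N(3) unfolding p_nilpotent_def by metis
  qed
qed

text \<open>
  Counting fibres over \<open>M\<close> and over \<open>N\<close> splits the index \<open>p ^ k\<close> of \<open>N\<close> in \<open>M\<close> into the index of the
  images and the index of the two kernels, so both of these are powers of \<open>p\<close>.
\<close>

lemma (in group_hom) normal_p_complement_image:
  assumes surj: "h ` carrier G = carrier H" and fin: "finite (carrier G)" and p: "prime p"
    and M: "M \<lhd> G" and N: "normal_p_complement p G M N"
  shows "normal_p_complement p H (h ` M) (h ` N)"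
proof -
  obtain k where N': "N \<lhd> G" "N \<subseteq> M" "\<not> p dvd card N" and k: "card M = card N * p ^ k"
    using N by (auto simp: normal_p_complement_def)
  interpret M: normal M G by fact
  interpret N: normal N G by fact
  have finM: "finite M" "finite N" using fin M.subset N.subset finite_subset by auto
  let ?M1 = "M \<inter> kernel G H h" and ?N1 = "N \<inter> kernel G H h"
  have ker: "{x \<in> A. h x = \<one>\<^bsub>H\<^esub>} = A \<inter> kernel G H h" if "A \<subseteq> carrier G" for A
    using that by (auto simp: kernel_def)
  have cM: "card M = card (h ` M) * card ?M1"
    using card_image_mult_card_fibre[OF M.is_subgroup finM(1)] ker[OF M.subset] by simp
  have cN: "card N = card (h ` N) * card ?N1"
    using card_image_mult_card_fibre[OF N.is_subgroup finM(2)] ker[OF N.subset] by simp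
  have sub: "subgroup ?M1 G" "subgroup ?N1 G"
    using G.subgroups_Inter_pair M.is_subgroup N.is_subgroup subgroup_kernel by simp_all
  have "card ?N1 dvd card ?M1"
    using G.card_subgroup_dvd[OF sub(2,1)] N'(2) by auto
  then obtain b where b: "card ?M1 = card ?N1 * b" by (rule dvdE)
  have "card (h ` N) dvd card (h ` M)"
    using H.card_subgroup_dvd[OF subgroup_img_is_subgroup[OF N.is_subgroup]
        subgroup_img_is_subgroup[OF M.is_subgroup]] N'(2) by auto
  then obtain a where a: "card (h ` M) = card (h ` N) * a" by (rule dvdE)
  have pos: "card N > 0" using N'(3) by (metis dvd_0_right gr0I)
  have "card N * (a * b) = card N * p ^ k"
    using k unfolding cM cN a b by (simp add: mult_ac)
  then have "a * b = p ^ k" using pos by simp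
  then have "a dvd p ^ k" by (metis dvd_triv_left)
  then obtain i where "a = p ^ i" using p by (metis divides_primepow_nat)
  moreover have "\<not> p dvd card (h ` N)" using N'(3) cN by (metis dvd_mult2)
  moreover have "h ` N \<lhd> H" using N.surj_hom_normal_subgroup[OF group_hom_axioms surj] .
  ultimately show ?thesis using a N'(2) unfolding normal_p_complement_def by auto
qed

text \<open>
  \<open>M\<close> acts on \<open>H - {\<one>}\<close> by conjugation, and every stabilizer contains \<open>N\<close>, so all orbit lengths divide
  \<open>p ^ k\<close>.  If no point were fixed, \<open>p\<close> would divide every orbit length and hence \<open>card H - 1\<close>.
\<close>

lemma (in group) p_group_fixed_point:
  assumes fin: "finite (carrier G)" and p: "prime p"
    and M: "subgroup M G" and N: "subgroup N G" "N \<subseteq> M" "card M = card N * p ^ k"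
    and H: "H \<lhd> G" "p dvd card H" and NH: "N \<subseteq> centralizer G H"
  shows "\<exists>h\<in>H. h \<noteq> \<one> \<and> h \<in> centralizer G M"
proof (rule ccontr)
  assume nofix: "\<not> ?thesis"
  interpret H: normal H G by fact
  interpret M: subgroup M G by fact
  define \<phi> where "\<phi> = (\<lambda>g. \<lambda>x\<in>carrier G. g \<otimes> x \<otimes> inv g)"
  interpret act: group_action "G\<lparr>carrier := M\<rparr>" "carrier G" \<phi>
    unfolding \<phi>_def by (rule group_action.induced_action[OF action_by_conjugation M])
  let ?M = "G\<lparr>carrier := M\<rparr>"
  let ?H = "H - {\<one>}"
  let ?o = "orbit ?M \<phi>"
  have finM: "finite M" using finite_subset[OF M.subset fin] .
  have finH: "finite H" using finite_subset[OF H.subset fin] .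
  have \<phi>: "\<phi> g x = g \<otimes> x \<otimes> inv g" if "x \<in> carrier G" for g x
    using that by (simp add: \<phi>_def)
  have orb: "?o x = {g \<otimes> x \<otimes> inv g |g. g \<in> M}" if "x \<in> carrier G" for x
    using that by (simp add: orbit_def \<phi>)
  have orbH: "?o x \<subseteq> ?H" if "x \<in> ?H" for x
  proof -
    have x: "x \<in> carrier G" "x \<in> H" "x \<noteq> \<one>" using that by simp_all
    have "g \<otimes> x \<otimes> inv g \<in> ?H" if "g \<in> M" for g
    proof -
      have g: "g \<in> carrier G" using that by simp
      have "g \<otimes> x \<otimes> inv g \<noteq> \<one>"
        using inv_solve_right[of \<one> "g \<otimes> x" g] g x by auto
      then show ?thesis using H.inv_op_closed2[OF g x(2)] by simp
    qed
    then show ?thesis using orb[OF x(1)] by auto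
  qed
  have dvd: "p dvd card (?o x)" if "x \<in> ?H" for x
  proof -
    have x: "x \<in> carrier G" "x \<in> H" "x \<noteq> \<one>" using that by simp_all
    let ?S = "stabilizer ?M \<phi> x"
    have "N \<subseteq> ?S"
    proof
      fix n assume n: "n \<in> N"
      then have "n \<otimes> x = x \<otimes> n" "n \<in> M" "n \<in> carrier G"
        using NH x(2) N(2) by (auto simp: centralizer_def)
      then have "n \<otimes> x \<otimes> inv n = x" using conj_eq_self_iff x(1) by metis
      then show "n \<in> ?S" using \<open>n \<in> M\<close> x(1) by (simp add: stabilizer_def \<phi>)
    qed
    moreover have "subgroup ?S G"
      using incl_subgroup[OF M act.stabilizer_subgroup[OF x(1)]] .
    ultimately have "card N dvd card ?S" using card_subgroup_dvd N(1) by simp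
    then obtain c where c: "card ?S = card N * c" by (rule dvdE)
    have "card N > 0" using N(1) subgroup.finite_imp_card_positive fin by metis
    moreover have "card (?o x) * card ?S = card M"
      using act.orbit_stabilizer_theorem[OF x(1)] by (simp add: order_def)
    ultimately have "card (?o x) * c = p ^ k" using c N(3) by simp
    then have "card (?o x) dvd p ^ k" by (metis dvd_triv_left)
    then obtain i where i: "card (?o x) = p ^ i" using p by (metis divides_primepow_nat)
    have "i \<noteq> 0"
    proof
      assume "i = 0"
      then have "card (?o x) = 1" using i by simp
      then obtain y where y: "?o x = {y}" by (rule card_1_singletonE)
      then have "y = x" using act.orbit_refl[OF x(1)] by simp
      then have fixed: "g \<otimes> x \<otimes> inv g = x" if "g \<in> M" for g
        using that y orb[OF x(1)] by auto
      have "x \<otimes> g = g \<otimes> x" if "g \<in> M" for g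
        using fixed[OF that] conj_eq_self_iff[of g x] x(1) that by simp
      then show False using nofix x by (auto simp: centralizer_def)
    qed
    then show ?thesis using i by simp
  qed
  have "\<Union>(?o ` ?H) = ?H"
  proof
    show "\<Union>(?o ` ?H) \<subseteq> ?H" using orbH by (rule UN_least)
    show "?H \<subseteq> \<Union>(?o ` ?H)"
    proof
      fix x assume x: "x \<in> ?H"
      then have "x \<in> ?o x" using act.orbit_refl by simp
      then show "x \<in> \<Union>(?o ` ?H)" using x by (rule UN_I[rotated])
    qed
  qed
  moreover have "card (\<Union>(?o ` ?H)) = sum card (?o ` ?H)"
  proof (rule card_Union_disjoint)
    have "?o ` ?H \<subseteq> orbits ?M (carrier G) \<phi>" by (auto simp: orbits_def)
    then show "pairwise disjnt (?o ` ?H)"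
      using act.disjoint_union by (intro pairwiseI) (simp only: disjnt_def subset_iff, metis)
    show "finite A" if "A \<in> ?o ` ?H" for A
      using that orbH finH by (metis (no_types, lifting) finite_Diff finite_subset imageE)
  qed
  moreover have "p dvd sum card (?o ` ?H)"
    by (rule dvd_sum) (use dvd in auto)
  ultimately have "p dvd card ?H" by simp
  moreover have "card H = Suc (card ?H)"
    using card.remove[OF finH H.one_closed] .
  ultimately have "p dvd 1" using H(2) by (metis Suc_eq_plus1 dvd_add_right_iff)
  then show False using p not_prime_unit by metis
qed

text \<open>
  Each of \<open>N \<inter> H\<close>, \<open>M \<inter> H\<close> and the set of fixed points of \<open>M\<close> in \<open>H\<close> is normal in \<open>G\<close>, hence trivial or
  \<open>H\<close>.  The first is trivial because \<open>p\<close> divides \<open>card H\<close>; normal subgroups that meet trivially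
  commute.
\<close>

lemma (in group) normal_p_complement_centralizes_minimal_normal:
  assumes fin: "finite (carrier G)" and p: "prime p"
    and H: "chief_factor G H {\<one>}" "p dvd card H"
    and M: "M \<lhd> G" "normal_p_complement p G M N"
  shows "M \<subseteq> centralizer G H"
proof -
  have HG: "H \<lhd> G"
    and min: "\<And>L. L \<lhd> G \<Longrightarrow> \<one> \<in> L \<Longrightarrow> L \<subseteq> H \<Longrightarrow> L = {\<one>} \<or> L = H"
    using H(1) by (auto simp: chief_factor_def)
  obtain k where N: "N \<lhd> G" "N \<subseteq> M" "\<not> p dvd card N" "card M = card N * p ^ k"
    using M(2) by (auto simp: normal_p_complement_def)
  interpret H: normal H G by fact
  interpret M: normal M G by fact
  interpret N: normal N G by fact
  have commute: "A \<subseteq> centralizer G H" if "A \<lhd> G" "A \<inter> H = {\<one>}" for A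
    using that normal_imp_commuting[OF that(1) HG] subgroup.subset[OF normal_imp_subgroup[OF that(1)]]
    unfolding centralizer_def by auto
  have "N \<inter> H = {\<one>} \<or> N \<inter> H = H"
    by (rule min) (use normal_subgroup_intersect[OF N(1) HG] in auto)
  moreover have "N \<inter> H \<noteq> H"
  proof
    assume "N \<inter> H = H"
    then have "card H dvd card N" using card_subgroup_dvd[OF H.is_subgroup N.is_subgroup] by auto
    then show False using H(2) N(3) dvd_trans by metis
  qed
  ultimately have NH: "N \<subseteq> centralizer G H" using commute[OF N(1)] by simp
  have "M \<inter> H = {\<one>} \<or> M \<inter> H = H"
    by (rule min) (use normal_subgroup_intersect[OF M(1) HG] in auto)
  then show ?thesis
  proof
    assume "M \<inter> H = {\<one>}"
    then show ?thesis using commute[OF M(1)] by simp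
  next
    obtain h where h: "h \<in> H" "h \<noteq> \<one>" "h \<in> centralizer G M"
      using p_group_fixed_point[OF fin p M.is_subgroup N.is_subgroup N(2,4) HG H(2) NH] by metis
    have "centralizer G M \<inter> H = {\<one>} \<or> centralizer G M \<inter> H = H"
      by (rule min) (use normal_subgroup_intersect[OF normal_centralizer[OF M(1)] HG] 
          subgroup.one_closed[OF subgroup_centralizer[OF M.subset]] in auto)
    then have "H \<subseteq> centralizer G M" using h by auto
    then show ?thesis using M.subset unfolding centralizer_def by auto
  qed
qed

lemma p_nilpotent_subset_centralizer_factor:
  fixes G (structure)
  assumes G: "finite_group G" and p: "prime p"
    and chief: "chief_factor G H K" and pHK: "p dvd order (G\<lparr>carrier := H\<rparr> Mod K)"
    and M: "M \<lhd> G" "p_nilpotent p (G\<lparr>carrier := M\<rparr>)"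
  shows "M \<subseteq> centralizer_factor G H K"
proof -
  have fin: "finite (carrier G)" using G by (simp add: finite_group_def)
  have HK: "H \<lhd> G" "K \<lhd> G" "K \<subseteq> H" using chief by (auto simp: chief_factor_def)
  interpret K: normal K G by fact
  interpret H: normal H G by fact
  interpret M: normal M G by fact
  interpret q: group_hom G "G Mod K" "\<lambda>x. K #> x" by (rule K.hom_Mod)
  let ?\<phi> = "\<lambda>x. K #> x"
  have surj: "?\<phi> ` carrier G = carrier (G Mod K)" by (simp add: carrier_FactGroup)
  obtain N where N: "normal_p_complement p G M N"
    using M(2) p_nilpotent_iff_normal_p_complement[OF G p M(1)] by auto
  have finH: "finite H" "finite K" using fin H.subset K.subset finite_subset by auto
  have "card K > 0" using K.finite_imp_card_positive[OF fin] .
  then have "card (?\<phi> ` H) = order (G\<lparr>carrier := H\<rparr> Mod K)"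
    using K.card_quotient[OF H.is_subgroup HK(3) finH(1)]
      finite_group_Mod_restrict(2)[OF G HK] by simp
  then have "p dvd card (?\<phi> ` H)" using pHK by simp
  moreover have "finite (carrier (G Mod K))" using fin surj by (metis finite_imageI)
  moreover have "?\<phi> ` M \<lhd> G Mod K"
    using M.surj_hom_normal_subgroup[OF K.hom_Mod surj] .
  ultimately have "?\<phi> ` M \<subseteq> centralizer (G Mod K) (?\<phi> ` H)"
    using q.H.normal_p_complement_centralizes_minimal_normal[OF _ p K.chief_factor_Mod[OF chief]]
      q.normal_p_complement_image[OF surj fin p M(1) N] by simp
  then have "K #> x \<in> centralizer (G Mod K) (?\<phi> ` H)" if "x \<in> M" for x
    using imageI[OF that, of ?\<phi>] by (rule subsetD)
  then show ?thesis
    unfolding K.centralizer_factor_eq_vimage[OF HK(2) H.subset] using M.subset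
    by (simp add: subset_iff)
qed

section \<open>Transfer into a central subgroup\<close>

lemma (in group) telescope:
  assumes "a \<in> carrier G" "b \<in> carrier G" "c \<in> carrier G" "x \<in> carrier G" "y \<in> carrier G"
  shows "a \<otimes> x \<otimes> inv b \<otimes> (b \<otimes> y \<otimes> inv c) = a \<otimes> (x \<otimes> y) \<otimes> inv c"
proof -
  have "inv b \<otimes> (b \<otimes> (y \<otimes> inv c)) = y \<otimes> inv c"
    using assms by (simp flip: m_assoc)
  then show ?thesis using assms by (simp add: m_assoc)
qed

text \<open>
  The transfer of \<open>G\<close> into a central subgroup \<open>Z\<close>, which is the kernel of a surjection \<open>h\<close> onto \<open>H\<close>.
  For a transversal \<open>s\<close> put \<open>V x = (\<Prod>c\<in>H. s c \<otimes> x \<otimes> inv s (c \<otimes> h x))\<close>.  Each factor lies in \<open>Z\<close>; the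
  factors for \<open>x \<otimes> y\<close> telescope, and reindexing along right translation by \<open>h x\<close> yields
  multiplicativity.  For \<open>x\<close> in \<open>Z\<close> every factor is \<open>x\<close>.
\<close>

lemma (in group_hom) central_transfer:
  assumes fin: "finite (carrier G)" and surj: "h ` carrier G = carrier H"
    and ker: "kernel G H h = Z" and central: "Z \<subseteq> centralizer G (carrier G)"
  shows "\<exists>V \<in> hom G (G\<lparr>carrier := Z\<rparr>). \<forall>z\<in>Z. V z = z [^] card (carrier H)"
proof -
  let ?T = "carrier H"
  have Z: "subgroup Z G" using subgroup_kernel ker by simp
  then interpret Z: subgroup Z G .
  have comm: "z \<otimes> x = x \<otimes> z" if "z \<in> Z" "x \<in> carrier G" for z x
    using that central by (auto simp: centralizer_def)
  have conj: "x \<otimes> z \<otimes> inv x = z" if "z \<in> Z" "x \<in> carrier G" for z x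
    using that comm Z.mem_carrier G.conj_eq_self_iff by metis
  have h1: "h x = \<one>\<^bsub>H\<^esub> \<longleftrightarrow> x \<in> Z" if "x \<in> carrier G" for x
    using that ker by (auto simp: kernel_def)
  have finT: "finite ?T" using fin surj by (metis finite_imageI)
  interpret C: comm_group "G\<lparr>carrier := Z\<rparr>"
    using G.subgroup_imp_group[OF Z] comm Z.mem_carrier
    by (intro group.group_comm_groupI) auto
  \<comment> \<open>a transversal of the cosets of \<open>Z\<close>, indexed by the elements of \<open>H\<close>\<close>
  define s where "s = (\<lambda>c. SOME x. x \<in> carrier G \<and> h x = c)"
  have s: "s c \<in> carrier G" "h (s c) = c" if "c \<in> ?T" for c
  proof -
    have "\<exists>x. x \<in> carrier G \<and> h x = c" using that unfolding surj[symmetric] by auto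
    then have "s c \<in> carrier G \<and> h (s c) = c" unfolding s_def by (rule someI_ex)
    then show "s c \<in> carrier G" "h (s c) = c" by simp_all
  qed
  define d where "d = (\<lambda>c x. s c \<otimes> x \<otimes> inv s (c \<otimes>\<^bsub>H\<^esub> h x))"
  have dZ: "d c x \<in> Z" if c: "c \<in> ?T" and x: "x \<in> carrier G" for c x
  proof -
    have cx: "c \<otimes>\<^bsub>H\<^esub> h x \<in> ?T" using c x by simp
    have "h (d c x) = \<one>\<^bsub>H\<^esub>"
      unfolding d_def using s[OF c] s[OF cx] x cx by simp
    moreover have "d c x \<in> carrier G" using s(1)[OF c] s(1)[OF cx] x by (simp add: d_def)
    ultimately show ?thesis using h1 by simp
  qed
  define V where "V = (\<lambda>x. finprod (G\<lparr>carrier := Z\<rparr>) (\<lambda>c. d c x) ?T)"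
  have VZ: "V x \<in> Z" if "x \<in> carrier G" for x
    unfolding V_def using C.finprod_closed[of "\<lambda>c. d c x" ?T] dZ that by (simp add: Pi_iff)
  have "V (x \<otimes> y) = V x \<otimes> V y" if x: "x \<in> carrier G" and y: "y \<in> carrier G" for x y
  proof -
    let ?r = "\<lambda>c. c \<otimes>\<^bsub>H\<^esub> h x"
    have inj: "inj_on ?r ?T" using H.inj_on_multc[of "h x"] x by simp
    have "?r ` ?T \<subseteq> ?T" using x H.m_closed hom_closed by (intro image_subsetI) simp
    then have img: "?r ` ?T = ?T" using endo_inj_surj[OF finT _ inj] by simp
    have d_mult: "d c (x \<otimes> y) = d c x \<otimes> d (?r c) y" if c: "c \<in> ?T" for c
    proof -
      have cx: "?r c \<in> ?T" using c x by simp
      have cxy: "?r c \<otimes>\<^bsub>H\<^esub> h y \<in> ?T" using cx y by simp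
      have e: "c \<otimes>\<^bsub>H\<^esub> h (x \<otimes> y) = ?r c \<otimes>\<^bsub>H\<^esub> h y"
        using c x y H.m_assoc by simp
      show ?thesis
        unfolding d_def e
        using G.telescope[OF s(1)[OF c] s(1)[OF cx] s(1)[OF cxy] x y] by simp
    qed
    have "V (x \<otimes> y) = finprod (G\<lparr>carrier := Z\<rparr>) (\<lambda>c. d c x \<otimes>\<^bsub>G\<lparr>carrier := Z\<rparr>\<^esub> d (?r c) y) ?T"
      unfolding V_def using d_mult dZ x y H.m_closed hom_closed
      by (intro C.finprod_cong') (simp_all add: Pi_iff)
    also have "\<dots> = V x \<otimes> finprod (G\<lparr>carrier := Z\<rparr>) (\<lambda>c. d (?r c) y) ?T"
      unfolding V_def using dZ x y H.m_closed hom_closed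
      by (subst C.finprod_multf) (simp_all add: Pi_iff)
    also have "finprod (G\<lparr>carrier := Z\<rparr>) (\<lambda>c. d (?r c) y) ?T
        = finprod (G\<lparr>carrier := Z\<rparr>) (\<lambda>c. d c y) (?r ` ?T)"
      by (rule C.finprod_reindex[symmetric]) (use inj img dZ y in \<open>simp_all add: Pi_iff\<close>)
    finally show ?thesis unfolding img V_def .
  qed
  then have "V \<in> hom G (G\<lparr>carrier := Z\<rparr>)" using VZ by (simp add: hom_def Pi_iff)
  moreover have "V z = z [^] card ?T" if z: "z \<in> Z" for z
  proof -
    have zc: "z \<in> carrier G" using z by simp
    have "d c z = z" if c: "c \<in> ?T" for c
    proof -
      have "h z = \<one>\<^bsub>H\<^esub>" using h1 zc z by simp
      then have "c \<otimes>\<^bsub>H\<^esub> h z = c" using c H.r_one by metis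
      then show ?thesis unfolding d_def using conj[OF z] s(1)[OF c] by simp
    qed
    then have "V z = finprod (G\<lparr>carrier := Z\<rparr>) (\<lambda>c. z) ?T"
      unfolding V_def using z by (intro C.finprod_cong') (simp_all add: Pi_iff)
    also have "\<dots> = z [^]\<^bsub>G\<lparr>carrier := Z\<rparr>\<^esub> card ?T" using z by (intro C.finprod_const) simp
    finally show ?thesis by (simp flip: G.nat_pow_consistent)
  qed
  ultimately show ?thesis by blast
qed

text \<open>
  The central case of the Schur-Zassenhaus theorem.  On \<open>Z\<close> the transfer is the \<open>m\<close>-th power map,
  which is injective as \<open>m\<close> is prime to \<open>card Z\<close>; so the kernel of the transfer has order \<open>m\<close>.  It is
  described by the equation \<open>x [^] m = \<one>\<close>, which makes it characteristic.
\<close>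

lemma (in group) complement_of_central_p_subgroup:
  assumes fin: "finite (carrier G)" and p: "prime p"
    and Z: "subgroup Z G" "Z \<subseteq> centralizer G (carrier G)" "card Z = p ^ a"
    and m: "order G = card Z * m" "\<not> p dvd m"
  shows "subgroup {x \<in> carrier G. x [^] m = \<one>} G" "card {x \<in> carrier G. x [^] m = \<one>} = m"
proof -
  interpret Z: subgroup Z G by fact
  have cZ: "card Z > 0" using Z.finite_imp_card_positive[OF fin] .
  have "card (rcosets Z) = m" using lagrange[OF Z(1)] m(1) cZ by simp
  then have card_Mod: "card (carrier (G Mod Z)) = m" by (simp add: FactGroup_def)
  have "x \<otimes> z \<otimes> inv x \<in> Z" if "x \<in> carrier G" "z \<in> Z" for x z
    using that Z(2) conj_eq_self_iff[of x z] by (auto simp: centralizer_def)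
  then have "Z \<lhd> G" using Z(1) by (simp add: normal_inv_iff)
  then interpret ZN: normal Z G .
  obtain V where V: "V \<in> hom G (G\<lparr>carrier := Z\<rparr>)" and Vz: "\<And>z. z \<in> Z \<Longrightarrow> V z = z [^] m"
    using group_hom.central_transfer[OF ZN.hom_Mod fin _ ZN.kernel_Mod Z(2)] card_Mod
    by (auto simp: carrier_FactGroup)
  interpret V: group_hom G "G\<lparr>carrier := Z\<rparr>" V
    using V subgroup_imp_group[OF Z(1)] by (simp add: group_hom_def group_hom_axioms_def)
  have cop: "coprime (p ^ a) m"
    using p m(2) by (metis coprime_power_left_iff prime_imp_coprime)
  have one: "z = \<one>" if "z \<in> Z" "z [^] m = \<one>" for z
    using coprime_pow_imp_one[OF _ _ that(2) cop, of] subgroup_pow_card[OF Z(1) that(1)] Z(3) that(1)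
    by simp
  have "inj_on V Z"
  proof (rule inj_onI)
    fix z w assume zw: "z \<in> Z" "w \<in> Z" "V z = V w"
    have "V (z \<otimes> inv w) = \<one>"
      using zw V.hom_mult[of z "inv w"] V.hom_inv[of w] V.hom_closed[of w] V.H.r_inv[of "V w"] by simp
    then have "(z \<otimes> inv w) [^] m = \<one>" using Vz[of "z \<otimes> inv w"] zw by simp
    then have "z \<otimes> inv w = \<one>" using one[of "z \<otimes> inv w"] zw by simp
    then have "\<one> \<otimes> w = z" using inv_solve_right[of \<one> z w] zw by simp
    then show "z = w" using zw by simp
  qed
  then have "card (V ` Z) = card Z" by (rule card_image)
  moreover have VG: "V ` carrier G \<subseteq> Z" using V.hom_closed by auto
  moreover have "V ` Z \<subseteq> V ` carrier G" using Z.subset by auto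
  moreover have finZ: "finite Z" using finite_subset[OF Z.subset fin] .
  ultimately have "V ` carrier G = Z"
    using card_seteq[OF finZ, of "V ` carrier G"] card_mono[of "V ` carrier G" "V ` Z"] fin by simp
  moreover have "{x \<in> carrier G. V x = \<one>} = kernel G (G\<lparr>carrier := Z\<rparr>) V" by (simp add: kernel_def)
  ultimately have "order G = card Z * card (kernel G (G\<lparr>carrier := Z\<rparr>) V)"
    using V.card_image_mult_card_fibre[OF subgroup_self fin] by (simp add: order_def)
  then have card_ker: "card (kernel G (G\<lparr>carrier := Z\<rparr>) V) = m" using m(1) cZ by simp
  have "{x \<in> carrier G. x [^] m = \<one>} = kernel G (G\<lparr>carrier := Z\<rparr>) V"
  proof (rule Set.set_eqI)
    fix x
    have "V x = \<one>" if x: "x \<in> carrier G" "x [^] m = \<one>"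
    proof -
      have "V x [^] m = \<one>"
        using V.hom_nat_pow[OF x(1), of m] x(2) V.hom_one by (simp flip: nat_pow_consistent)
      then show ?thesis using one[of "V x"] V.hom_closed[OF x(1)] by simp
    qed
    moreover have "x [^] m = \<one>" if "x \<in> kernel G (G\<lparr>carrier := Z\<rparr>) V"
      using subgroup_pow_card[OF V.subgroup_kernel that] card_ker by simp
    ultimately show "x \<in> {x \<in> carrier G. x [^] m = \<one>} \<longleftrightarrow> x \<in> kernel G (G\<lparr>carrier := Z\<rparr>) V"
      by (auto simp: kernel_def)
  qed
  then show "subgroup {x \<in> carrier G. x [^] m = \<one>} G" "card {x \<in> carrier G. x [^] m = \<one>} = m"
    using V.subgroup_kernel card_ker by simp_all
qed

text \<open>
  In an abelian \<open>H\<close> the elements killed by a fixed power of \<open>p\<close> form a subgroup that is normal in \<open>G\<close>.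
  For a suitable power it is nontrivial, hence all of \<open>H\<close>, and then no other prime divides \<open>card H\<close>.
\<close>

lemma (in group) card_abelian_minimal_normal:
  assumes fin: "finite (carrier G)" and p: "prime p"
    and H: "chief_factor G H {\<one>}" "p dvd card H" "H \<subseteq> centralizer G H"
  shows "\<exists>a. card H = p ^ a"
proof -
  have HG: "H \<lhd> G"
    and min: "\<And>L. L \<lhd> G \<Longrightarrow> \<one> \<in> L \<Longrightarrow> L \<subseteq> H \<Longrightarrow> L = {\<one>} \<or> L = H"
    using H(1) by (auto simp: chief_factor_def)
  interpret H: normal H G by fact
  have finH: "finite H" using finite_subset[OF H.subset fin] .
  have comm: "x \<otimes> y = y \<otimes> x" if "x \<in> H" "y \<in> H" for x y
    using that H(3) by (auto simp: centralizer_def)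
  obtain x k where x: "x \<in> H" "x \<noteq> \<one>" "x [^] (p ^ k) = \<one>"
    using p_elementE[OF H.is_subgroup finH p H(2)] .
  let ?T = "{y \<in> H. y [^] (p ^ k) = \<one>}"
  have "?T \<lhd> G"
    unfolding normal_inv_iff
  proof (intro conjI ballI)
    show "subgroup ?T G"
    proof (rule subgroupI)
      show "?T \<subseteq> carrier G" using H.subset by auto
      show "?T \<noteq> {}" using x by auto
      show "inv a \<in> ?T" if "a \<in> ?T" for a
        using that by (simp add: nat_pow_inv)
      show "a \<otimes> b \<in> ?T" if "a \<in> ?T" "b \<in> ?T" for a b
        using that pow_mult_distrib[OF comm] by simp
    qed
    show "g \<otimes> y \<otimes> inv g \<in> ?T" if "g \<in> carrier G" "y \<in> ?T" for g y
      using that H.inv_op_closed2 conj_pow by simp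
  qed
  then have "?T = {\<one>} \<or> ?T = H" by (rule min) auto
  then have T: "y [^] (p ^ k) = \<one>" if "y \<in> H" for y using that x by auto
  have "card H \<noteq> 0" using H.finite_imp_card_positive[OF fin] by simp
  then obtain a m where am: "card H = p ^ a * m" "\<not> p dvd m"
    using multiplicity_decompose'[of "card H" p] p not_prime_unit by metis
  have "m = 1"
  proof (rule ccontr)
    assume "m \<noteq> 1"
    then obtain q where q: "prime q" "q dvd m" using prime_factor_nat by metis
    then have "q dvd card H" using am by simp
    then obtain y j where y: "y \<in> H" "y \<noteq> \<one>" "y [^] (q ^ j) = \<one>"
      using p_elementE[OF H.is_subgroup finH q(1)] by metis
    have "coprime p q" using q am(2) p primes_coprime by metis
    then have "coprime (p ^ k) (q ^ j)" by simp
    then have "y = \<one>" using coprime_pow_imp_one[OF _ T[OF y(1)] y(3)] y(1) by simp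
    then show False using y(2) by simp
  qed
  then show ?thesis using am by auto
qed

lemma (in group) complement_of_central_minimal_normal:
  assumes fin: "finite (carrier G)" and p: "prime p"
    and H: "chief_factor G H {\<one>}" "p dvd card H"
    and L: "L \<lhd> G" "H \<subseteq> L" "L \<subseteq> centralizer G H" "card L = card H * m" "\<not> p dvd m"
  shows "\<exists>R a. R \<lhd> G \<and> R \<subseteq> L \<and> card R = m \<and> card H = p ^ a"
proof -
  have HG: "H \<lhd> G" using H(1) by (simp add: chief_factor_def)
  interpret H: normal H G by fact
  interpret L: normal L G by fact
  obtain a where a: "card H = p ^ a"
    using card_abelian_minimal_normal[OF fin p H] L(2,3) by auto
  let ?L = "G\<lparr>carrier := L\<rparr>"
  interpret GL: group ?L using subgroup_imp_group[OF L.is_subgroup] .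
  have sub: "subgroup H ?L" using subgroup_incl[OF H.is_subgroup L.is_subgroup L(2)] .
  have "H \<subseteq> centralizer ?L (carrier ?L)"
    using L(2,3) by (auto simp: centralizer_def)
  moreover have "finite (carrier ?L)" using finite_subset[OF L.subset fin] by simp
  moreover have "order ?L = card H * m" using L(4) by (simp add: order_def)
  ultimately have "subgroup {x \<in> carrier ?L. x [^]\<^bsub>?L\<^esub> m = \<one>\<^bsub>?L\<^esub>} ?L"
      "card {x \<in> carrier ?L. x [^]\<^bsub>?L\<^esub> m = \<one>\<^bsub>?L\<^esub>} = m"
    using GL.complement_of_central_p_subgroup[OF _ p sub _ a _ L(5)] by simp_all
  then have R: "subgroup {x \<in> L. x [^] m = \<one>} ?L" "card {x \<in> L. x [^] m = \<one>} = m"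
    by (simp_all flip: nat_pow_consistent)
  have "subgroup {x \<in> L. x [^] m = \<one>} G" using incl_subgroup[OF L.is_subgroup R(1)] .
  moreover have "g \<otimes> y \<otimes> inv g \<in> {x \<in> L. x [^] m = \<one>}"
    if "g \<in> carrier G" "y \<in> {x \<in> L. x [^] m = \<one>}" for g y
    using that L.inv_op_closed2 conj_pow by simp
  ultimately have "{x \<in> L. x [^] m = \<one>} \<lhd> G" by (simp add: normal_inv_iff)
  moreover have "{x \<in> L. x [^] m = \<one>} \<subseteq> L" by auto
  ultimately show ?thesis using R(2) a by metis
qed

section \<open>Groups acting trivially on their p-chief factors\<close>

lemma (in group) chief_factor_below:
  assumes fin: "finite (carrier G)" and H: "H \<lhd> G" "H \<noteq> {\<one>}"
  obtains K where "chief_factor G H K"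
proof -
  let ?S = "{K. K \<lhd> G \<and> K \<subset> H}"
  interpret H: normal H G by fact
  have "?S \<subseteq> Pow (carrier G)" using H.subset by auto
  then have finS: "finite ?S" using fin finite_subset finite_Pow_iff by metis
  moreover have "{\<one>} \<in> ?S" using one_is_normal H(2) H.one_closed by auto
  then have "?S \<noteq> {}" by auto
  ultimately obtain K where K: "K \<in> ?S" and max: "\<forall>L\<in>?S. K \<subseteq> L \<longrightarrow> K = L"
    by (rule finite_has_maximal[THEN bexE]) auto
  then have "chief_factor G H K" using H(1) unfolding chief_factor_def by auto
  then show ?thesis by (rule that)
qed

lemma order_chief_factor:
  assumes G: "finite_group G" and HK: "chief_factor G H K"
  shows "card H = card K * order (G\<lparr>carrier := H\<rparr> Mod K)"
  using HK finite_group_Mod_restrict(2)[OF G, of H K] by (simp add: chief_factor_def psubset_eq mult.commute)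

text \<open>
  The order of a group is the product of the orders of the factors in a chief series.
\<close>

lemma exists_chief_factor_of_prime:
  assumes G: "finite_group G" and p: "prime p" "p dvd order G"
  shows "\<exists>H K. chief_factor G H K \<and> p dvd order (G\<lparr>carrier := H\<rparr> Mod K)"
proof -
  interpret group G using G by (simp add: finite_group_def)
  have fin: "finite (carrier G)" using G by (simp add: finite_group_def)
  have "\<exists>H K. chief_factor G H K \<and> p dvd order (G\<lparr>carrier := H\<rparr> Mod K)"
    if "H \<lhd> G" "p dvd card H" for H
    using that
  proof (induction "card H" arbitrary: H rule: less_induct)
    case less
    have "H \<noteq> {\<one>\<^bsub>G\<^esub>}" using less.prems p(1) by (auto simp: not_prime_unit)
    then obtain K where K: "chief_factor G H K" using chief_factor_below[OF fin less.prems(1)] by metis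
    then have KG: "K \<lhd> G" "K \<subset> H" by (auto simp: chief_factor_def)
    have "finite H" using finite_subset fin less.prems(1) normal_imp_subgroup subgroup.subset by metis
    then have "card K < card H" using KG(2) by (rule psubset_card_mono)
    moreover have "p dvd card K \<or> p dvd order (G\<lparr>carrier := H\<rparr> Mod K)"
      using less.prems(2) order_chief_factor[OF G K] p(1) prime_dvd_mult_iff by metis
    ultimately show ?case using less.hyps[OF _ KG(1)] K by metis
  qed
  moreover note normal_carrier
  ultimately show ?thesis using p(2) by (simp add: order_def)
qed

text \<open>
  One step of the descent along a chief series: with \<open>K\<close> the kernel and \<open>A/K\<close> a \<open>p\<close>-chief factor that is
  central in \<open>L/K\<close>, the preimage \<open>L'\<close> of the complement of \<open>A/K\<close> in \<open>L/K\<close> trades the factor \<open>A/K\<close> at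
  the bottom of \<open>L\<close> for a \<open>p\<close>-power index at its top.
\<close>

lemma (in group_hom) central_chief_factor_step:
  assumes fin: "finite (carrier G)" and surj: "h ` carrier G = carrier H" and p: "prime p"
    and chief: "chief_factor G A (kernel G H h)"
    and cA: "card A = card (kernel G H h) * c" and pc: "p dvd c"
    and L: "L \<lhd> G" "A \<subseteq> L" "card L = card A * m" "\<not> p dvd m"
    and central: "h ` L \<subseteq> centralizer H (h ` A)"
  shows "\<exists>L' a. L' \<lhd> G \<and> kernel G H h \<subseteq> L' \<and> L' \<subseteq> L \<and>
    card L' = card (kernel G H h) * m \<and> card L = card L' * p ^ a"
proof -
  let ?K = "kernel G H h"
  have A: "A \<lhd> G" "?K \<subseteq> A" using chief by (auto simp: chief_factor_def)
  interpret A: normal A G by fact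
  interpret L: normal L G by fact
  have fins: "finite A" "finite L" "finite ?K"
    using finite_subset[OF A.subset fin] finite_subset[OF L.subset fin] fin
    by (simp_all add: kernel_def)
  have cK: "card ?K > 0" using subgroup.finite_imp_card_positive[OF subgroup_kernel fin] .
  have fibre: "card B = card (h ` B) * card ?K" if "subgroup B G" "?K \<subseteq> B" for B
  proof -
    have "{x \<in> B. h x = \<one>\<^bsub>H\<^esub>} = ?K" using that subgroup.subset[OF that(1)] by (auto simp: kernel_def)
    then show ?thesis
      using card_image_mult_card_fibre[OF that(1) finite_subset[OF subgroup.subset[OF that(1)] fin]] by simp
  qed
  have chA: "card (h ` A) = c" using fibre[OF A.is_subgroup A(2)] cA cK by simp
  have "card (h ` L) = card (h ` A) * m"
    using fibre[OF L.is_subgroup] A(2) L(2,3) cA chA cK by simp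
  moreover have "h ` L \<lhd> H" using L.surj_hom_normal_subgroup[OF group_hom_axioms surj] .
  moreover have "h ` A \<subseteq> h ` L" using L(2) by auto
  moreover have "finite (carrier H)" using fin surj by (metis finite_imageI)
  moreover have "p dvd card (h ` A)" using chA pc by simp
  ultimately obtain R a where R: "R \<lhd> H" "R \<subseteq> h ` L" "card R = m" "card (h ` A) = p ^ a"
    using H.complement_of_central_minimal_normal[OF _ p chief_factor_image[OF surj chief]
        _ _ _ central _ L(4)] by metis
  let ?R = "{x \<in> carrier G. h x \<in> R}"
  have RG: "?R \<lhd> G" using normal_vimage[OF R(1)] .
  have KR: "?K \<subseteq> ?R"
    using subgroup.one_closed[OF normal_imp_subgroup[OF R(1)]] by (auto simp: kernel_def)
  have "h ` ?R = R"
  proof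
    show "R \<subseteq> h ` ?R" using R(2) L.subset by auto
  qed auto
  then have cR: "card ?R = m * card ?K"
    using fibre[OF normal_imp_subgroup[OF RG] KR] R(3) by simp
  have "?R \<subseteq> {x \<in> carrier G. h x \<in> h ` L}" using R(2) by auto
  then have "?R \<subseteq> L"
    using vimage_image_eq[OF subset_trans[OF A(2) L(2)] L.is_subgroup] by simp
  moreover have "card L = card ?R * p ^ a"
    using L(3) cA cR chA R(4) by (simp add: mult_ac)
  ultimately show ?thesis using RG KR cR by (metis mult.commute)
qed

text \<open>
  The induction descends from \<open>H = M\<close> to the trivial subgroup.  Its invariant is that \<open>L/H\<close> has order
  prime to \<open>p\<close> and \<open>M/L\<close> has \<open>p\<close>-power order; for trivial \<open>H\<close> it says that \<open>L\<close> is a normal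
  \<open>p\<close>-complement of \<open>M\<close>.
\<close>

lemma p_nilpotent_if_central:
  fixes G (structure)
  assumes G: "finite_group G" and p: "prime p" and M: "M \<lhd> G"
    and central: "\<And>H K. chief_factor G H K \<Longrightarrow> p dvd order (G\<lparr>carrier := H\<rparr> Mod K) \<Longrightarrow>
      M \<subseteq> centralizer_factor G H K"
  shows "p_nilpotent p (G\<lparr>carrier := M\<rparr>)"
proof -
  interpret M: normal M G by fact
  have fin: "finite (carrier G)" using G by (simp add: finite_group_def)
  have "\<exists>N. normal_p_complement p G M N"
    if "H \<lhd> G" "L \<lhd> G" "H \<subseteq> L" "L \<subseteq> M" "card L = card H * m" "\<not> p dvd m" "card M = card L * p ^ k"
    for H L m k
    using that
  proof (induction "card H" arbitrary: H L m k rule: less_induct)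
    case less
    note prems = less.prems
    show ?case
    proof (cases "H = {\<one>}")
      case True
      then have "normal_p_complement p G M L"
        using prems unfolding normal_p_complement_def by auto
      then show ?thesis ..
    next
      case False
      then obtain K where K: "chief_factor G H K" using M.chief_factor_below[OF fin prems(1)] by metis
      then have KG: "K \<lhd> G" "K \<subset> H" by (auto simp: chief_factor_def)
      interpret K: normal K G by fact
      interpret q: group_hom G "G Mod K" "\<lambda>x. K #> x" by (rule K.hom_Mod)
      have Hsub: "H \<subseteq> carrier G" using prems M.subset by simp
      have "card K < card H" using finite_subset[OF Hsub fin] KG(2) by (rule psubset_card_mono)
      note IH = less.hyps[OF this KG(1)]
      let ?c = "order (G\<lparr>carrier := H\<rparr> Mod K)"
      have c: "card H = card K * ?c" using order_chief_factor[OF G K] .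
      show ?thesis
      proof (cases "p dvd ?c")
        case False
        then have "\<not> p dvd ?c * m" using p prems(6) prime_dvd_mult_iff by metis
        moreover have "card L = card K * (?c * m)" using prems(5) c by simp
        ultimately show ?thesis
          using IH[OF prems(2) _ prems(4) _ _ prems(7)] KG(2) prems(3) by auto
      next
        case True
        have MC: "M \<subseteq> centralizer_factor G H K" using central[OF K True] .
        have "(\<lambda>x. K #> x) ` L \<subseteq> centralizer (G Mod K) ((\<lambda>x. K #> x) ` H)"
        proof (rule image_subsetI)
          fix x assume "x \<in> L"
          then have "x \<in> centralizer_factor G H K" using MC prems(4) by (meson subsetD)
          then show "K #> x \<in> centralizer (G Mod K) ((\<lambda>x. K #> x) ` H)"
            unfolding M.centralizer_factor_eq_vimage[OF KG(1) Hsub] by simp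
        qed
        moreover have "(\<lambda>x. K #> x) ` carrier G = carrier (G Mod K)"
          by (simp add: carrier_FactGroup)
        ultimately obtain L' a where L': "L' \<lhd> G" "K \<subseteq> L'" "L' \<subseteq> L"
            "card L' = card K * m" "card L = card L' * p ^ a"
          using q.central_chief_factor_step[OF fin _ p, unfolded K.kernel_Mod,
              OF _ K c True prems(2,3,5,6)]
          by metis
        have "card M = card L' * p ^ (a + k)" using prems(7) L'(5) by (simp add: power_add)
        then show ?thesis
          using IH[OF L'(1,2) _ L'(4) prems(6)] L'(3) prems(4) by (meson subset_trans)
      qed
    qed
  qed
  \<comment> \<open>the descent starts with \<open>H = L = M\<close>, where both indices are \<open>1\<close>\<close>
  from this[OF M M, of 1 0] have "\<exists>N. normal_p_complement p G M N" 
    using prime_gt_1_nat[OF p] by simp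
  then show ?thesis using p_nilpotent_iff_normal_p_complement[OF G p M] by simp
qed

section \<open>The largest normal p-nilpotent subgroup\<close>

lemma (in group) normal_Inter:
  assumes "\<S> \<noteq> {}" "\<And>N. N \<in> \<S> \<Longrightarrow> N \<lhd> G"
  shows "\<Inter>\<S> \<lhd> G"
proof -
  have "subgroup (\<Inter>\<S>) G" using subgroups_Inter[OF _ assms(1)] assms(2) normal_imp_subgroup by metis
  moreover have "g \<otimes> x \<otimes> inv g \<in> \<Inter>\<S>" if "g \<in> carrier G" "x \<in> \<Inter>\<S>" for g x
  proof (rule InterI)
    fix N assume N: "N \<in> \<S>"
    then have "x \<in> N" using that(2) by (rule InterD[rotated])
    then show "g \<otimes> x \<otimes> inv g \<in> N" by (rule normal.inv_op_closed2[OF assms(2)[OF N] that(1)])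
  qed
  ultimately show ?thesis by (simp add: normal_inv_iff)
qed

text \<open>
  The whole group is included so that the intersection is right also for groups without chief
  factors of order divisible by \<open>p\<close>.
\<close>

definition p_chief_centralizers :: "nat \<Rightarrow> ('a, 'b) monoid_scheme \<Rightarrow> 'a set set" where
  "p_chief_centralizers p G =
     insert (carrier G) {centralizer_factor G H K |H K.
       chief_factor G H K \<and> p dvd order (G\<lparr>carrier := H\<rparr> Mod K)}"

lemma (in group) normal_p_chief_centralizers:
  "N \<in> p_chief_centralizers p G \<Longrightarrow> N \<lhd> G"
  using normal_carrier normal_centralizer_factor
  by (auto simp: p_chief_centralizers_def chief_factor_def)

text \<open>
  The intersection of the centralizers is itself \<open>p\<close>-nilpotent and contains every normal
  \<open>p\<close>-nilpotent subgroup.  In particular a largest one exists, so that the operator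
  \<^const>\<open>Greatest\<close> in the definition of \<^const>\<open>O_p'_p\<close> picks a meaningful value.
\<close>

lemma
  assumes G: "finite_group G" and p: "prime p"
  shows O_p'_p_eq_Inter: "O_p'_p p G = \<Inter>(p_chief_centralizers p G)"
    and normal_O_p'_p: "O_p'_p p G \<lhd> G"
    and p_nilpotent_O_p'_p: "p_nilpotent p (G\<lparr>carrier := O_p'_p p G\<rparr>)"
    and O_p'_p_greatest: "M \<lhd> G \<Longrightarrow> p_nilpotent p (G\<lparr>carrier := M\<rparr>) \<Longrightarrow> M \<subseteq> O_p'_p p G"
proof -
  interpret group G using G by (simp add: finite_group_def)
  let ?C = "\<Inter>(p_chief_centralizers p G)"
  have C: "?C \<lhd> G"
    by (rule normal_Inter) (simp_all add: normal_p_chief_centralizers, simp add: p_chief_centralizers_def)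
  have nilp: "p_nilpotent p (G\<lparr>carrier := ?C\<rparr>)"
    by (rule p_nilpotent_if_central[OF G p C]) (auto simp: p_chief_centralizers_def)
  have greatest: "M \<subseteq> ?C" if "M \<lhd> G" "p_nilpotent p (G\<lparr>carrier := M\<rparr>)" for M
  proof (rule Inter_greatest)
    fix N assume "N \<in> p_chief_centralizers p G"
    then show "M \<subseteq> N"
      using p_nilpotent_subset_centralizer_factor[OF G p _ _ that] 
        subgroup.subset[OF normal_imp_subgroup[OF that(1)]]
      by (auto simp: p_chief_centralizers_def)
  qed
  show eq: "O_p'_p p G = ?C"
    unfolding O_p'_p_def by (rule Greatest_equality) (use C nilp greatest in auto)
  show "O_p'_p p G \<lhd> G" "p_nilpotent p (G\<lparr>carrier := O_p'_p p G\<rparr>)"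
    using C nilp unfolding eq by simp_all
  show "M \<lhd> G \<Longrightarrow> p_nilpotent p (G\<lparr>carrier := M\<rparr>) \<Longrightarrow> M \<subseteq> O_p'_p p G"
    unfolding eq by (rule greatest)
qed

section \<open>Primes dividing the order of a quotient\<close>

lemma order_Mod_antimono:
  assumes G: "finite_group G" and NM: "N \<lhd> G" "M \<lhd> G" "N \<subseteq> M"
  shows "order (G Mod M) dvd order (G Mod N)"
proof -
  interpret group G using G by (simp add: finite_group_def)
  have "card N dvd card M" using card_subgroup_dvd NM normal_imp_subgroup by metis
  then obtain c where "card M = card N * c" by (rule dvdE)
  then have "order (G Mod N) * card N = order (G Mod M) * c * card N"
    unfolding finite_group_Mod(2)[OF G NM(1), symmetric]
    using finite_group_Mod(2)[OF G NM(2)] by (simp add: mult_ac)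
  then show ?thesis using card_normal_pos[OF G NM(1)] by simp
qed

text \<open>
  \<open>A/(A \<inter> B)\<close> embeds into \<open>G/B\<close>.
\<close>

lemma order_Mod_Int:
  assumes G: "finite_group G" and A: "A \<lhd> G" and B: "B \<lhd> G"
  shows "order (G Mod (A \<inter> B)) dvd order (G Mod A) * order (G Mod B)"
proof -
  interpret A: normal A G by fact
  interpret B: normal B G by fact
  interpret q: group_hom G "G Mod B" "\<lambda>x. B #>\<^bsub>G\<^esub> x" by (rule B.hom_Mod)
  have fin: "finite (carrier G)" using G by (simp add: finite_group_def)
  have AB: "A \<inter> B \<lhd> G" using A.normal_subgroup_intersect[OF A B] .
  let ?i = "card ((\<lambda>x. B #>\<^bsub>G\<^esub> x) ` A)"
  have "{x \<in> A. B #>\<^bsub>G\<^esub> x = \<one>\<^bsub>G Mod B\<^esub>} = A \<inter> B"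
    using B.rcos_eq_self_iff A.subset by auto
  then have "card A = ?i * card (A \<inter> B)"
    using q.card_image_mult_card_fibre[OF A.is_subgroup finite_subset[OF A.subset fin]] by simp
  then have "order (G Mod (A \<inter> B)) * card (A \<inter> B) = order (G Mod A) * ?i * card (A \<inter> B)"
    unfolding finite_group_Mod(2)[OF G AB, symmetric]
    using finite_group_Mod(2)[OF G A] by simp
  then have "order (G Mod (A \<inter> B)) = order (G Mod A) * ?i"
    using card_normal_pos[OF G AB] by simp
  moreover have sub: "subgroup ((\<lambda>x. B #>\<^bsub>G\<^esub> x) ` A) (G Mod B)"
    using q.subgroup_img_is_subgroup[OF A.is_subgroup] .
  then have "?i dvd order (G Mod B)"
    using q.H.card_subgroup_dvd[OF sub q.H.subgroup_self subgroup.subset[OF sub]]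
    by (simp add: order_def)
  ultimately show ?thesis by simp
qed

lemma prime_dvd_order_Mod_Inter:
  assumes G: "finite_group G" and q: "prime q"
    and S: "finite \<S>" "\<S> \<noteq> {}" "\<And>N. N \<in> \<S> \<Longrightarrow> N \<lhd> G"
    and dvd: "q dvd order (G Mod \<Inter>\<S>)"
  shows "\<exists>N\<in>\<S>. q dvd order (G Mod N)"
  using S dvd
proof (induction \<S> rule: finite_ne_induct)
  case (insert N \<S>)
  interpret group G using G by (simp add: finite_group_def)
  have "\<Inter>\<S> \<lhd> G" using normal_Inter[OF insert.hyps(2)] insert.prems(1) by simp
  then have "order (G Mod (N \<inter> \<Inter>\<S>)) dvd order (G Mod N) * order (G Mod \<Inter>\<S>)"
    using order_Mod_Int[OF G, of N] insert.prems(1) by simp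
  then have "q dvd order (G Mod N) * order (G Mod \<Inter>\<S>)"
    using insert.prems(2) by (auto intro: dvd_trans)
  then have "q dvd order (G Mod N) \<or> q dvd order (G Mod \<Inter>\<S>)"
    using prime_dvd_mult_iff[OF q] by simp
  moreover have "\<exists>N\<in>\<S>. q dvd order (G Mod N)" if "q dvd order (G Mod \<Inter>\<S>)"
    using insert.IH[OF _ that] insert.prems(1) by simp
  ultimately show ?case by auto
qed simp

lemma finite_group_Mod_O_p'_p:
  assumes "finite_group G" "prime p"
  shows "finite_group (G Mod O_p'_p p G)" "order G = order (G Mod O_p'_p p G) * card (O_p'_p p G)"
  using finite_group_Mod[OF assms(1) normal_O_p'_p[OF assms]] by simp_all

lemma group_primes_subset:
  assumes "finite_group G" "finite_group H" "order G dvd order H"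
  shows "group_primes G \<subseteq> group_primes H"
  using assms by (auto simp: in_group_primes_iff intro: dvd_trans)

lemma order_Mod_O_p'_p_of_p'_group:
  assumes G: "finite_group G" and p: "prime p" and np: "\<not> p dvd order G"
  shows "order (G Mod O_p'_p p G) = 1"
proof -
  interpret group G using G by (simp add: finite_group_def)
  have "normal_p_complement p G (carrier G) (carrier G)"
    using np normal_carrier unfolding normal_p_complement_def order_def
    by (auto intro!: exI[of _ 0])
  then have "p_nilpotent p (G\<lparr>carrier := carrier G\<rparr>)"
    using p_nilpotent_iff_normal_p_complement[OF G p normal_carrier] by auto
  then have "carrier G \<subseteq> O_p'_p p G" by (rule O_p'_p_greatest[OF G p normal_carrier])
  then have "O_p'_p p G = carrier G"
    using subgroup.subset[OF normal_imp_subgroup[OF normal_O_p'_p[OF G p]]] by simp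
  then have "order G = order (G Mod O_p'_p p G) * order G"
    using finite_group_Mod_O_p'_p(2)[OF G p] by (simp add: order_def)
  moreover have "order G > 0" using order_gt_0_iff_finite G by (simp add: finite_group_def)
  ultimately show ?thesis by simp
qed

section \<open>Hawkes graphs of isomorphic groups and direct products\<close>

lemma pverts_hawkes_graph: "pverts (hawkes_graph G) = group_primes G"
  by (simp add: hawkes_graph_def)

text \<open>
  The two conditions that \<open>p\<close> and \<open>q\<close> be vertices follow from the third one: if \<open>p\<close> does not divide the
  order of \<open>G\<close>, then \<open>G\<close> is its own normal \<open>p\<close>-complement and the quotient is trivial.
\<close>

lemma in_parcs_hawkes_graph_iff:
  assumes "finite_group G"
  shows "(p, q) \<in> parcs (hawkes_graph G) \<longleftrightarrow>
    prime p \<and> prime q \<and> q dvd order (G Mod O_p'_p p G)"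
proof (cases "prime p")
  case True
  note fin = finite_group_Mod_O_p'_p[OF assms True]
  have "q dvd order G" if "q dvd order (G Mod O_p'_p p G)"
    using that fin(2) by simp
  moreover have "p dvd order G" if "prime q" "q dvd order (G Mod O_p'_p p G)"
    using that order_Mod_O_p'_p_of_p'_group[OF assms True] not_prime_unit by metis
  ultimately show ?thesis
    using True by (auto simp: hawkes_graph_def in_group_primes_iff assms fin)
next
  case False
  then show ?thesis using assms by (simp add: hawkes_graph_def in_group_primes_iff)
qed

lemma (in group_hom) O_p'_p_image:
  assumes surj: "h ` carrier G = carrier H" and fin: "finite (carrier G)" and p: "prime p"
  shows "h ` O_p'_p p G \<subseteq> O_p'_p p H"
proof -
  have G: "finite_group G" using fin by (simp add: finite_group_def)
  have H: "finite_group H" using fin surj by (auto simp: finite_group_def intro: finite_imageI simp flip: surj)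
  note O = normal_O_p'_p[OF G p]
  have img: "h ` O_p'_p p G \<lhd> H"
    using normal.surj_hom_normal_subgroup[OF O group_hom_axioms surj] .
  obtain N where "normal_p_complement p G (O_p'_p p G) N"
    using p_nilpotent_O_p'_p[OF G p] p_nilpotent_iff_normal_p_complement[OF G p O] by auto
  then have "p_nilpotent p (H\<lparr>carrier := h ` O_p'_p p G\<rparr>)"
    using normal_p_complement_image[OF surj fin p O] p_nilpotent_iff_normal_p_complement[OF H p img]
    by auto
  then show ?thesis by (rule O_p'_p_greatest[OF H p img])
qed

text \<open>
  Applied in both directions, this yields equality of the orders, which suffices for comparing the
  graphs of isomorphic groups.
\<close>

lemma card_O_p'_p_le_iso:
  assumes G: "finite_group G" and H: "group H" and iso: "G \<cong> H" and p: "prime p"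
  shows "card (O_p'_p p G) \<le> card (O_p'_p p H)"
proof -
  obtain h where h: "h \<in> iso G H" using iso by (auto simp: is_iso_def)
  interpret group_hom G H h
    using h G H by (simp add: iso_def group_hom_def group_hom_axioms_def finite_group_def)
  have fin: "finite (carrier G)" using G by (simp add: finite_group_def)
  have surj: "h ` carrier G = carrier H" and inj: "inj_on h (carrier G)"
    using h by (auto simp: iso_def bij_betw_def)
  have H': "finite_group H" using H fin surj by (metis finite_group_def finite_imageI)
  have sub: "O_p'_p p K \<subseteq> carrier K" if "finite_group K" for K
    using subgroup.subset[OF normal_imp_subgroup[OF normal_O_p'_p[OF that p]]] .
  have "card (h ` O_p'_p p G) = card (O_p'_p p G)"
    by (rule card_image) (rule inj_on_subset[OF inj sub[OF G]])
  moreover have "finite (O_p'_p p H)"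
    using finite_subset[OF sub[OF H']] H' by (simp add: finite_group_def)
  ultimately show ?thesis
    using card_mono[OF _ O_p'_p_image[OF surj fin p]] by simp
qed

lemma finite_group_iso:
  assumes "finite_group G" "group H" "G \<cong> H"
  shows "finite_group H"
  using assms iso_finite by (auto simp: finite_group_def)

lemma group_primes_iso: "G \<cong> H \<Longrightarrow> group_primes G = group_primes H"
  by (simp add: group_primes_def order_def iso_same_card)

lemma hawkes_graph_iso:
  assumes G: "finite_group G" and H: "group H" and iso: "G \<cong> H"
  shows "hawkes_graph G = hawkes_graph H"
proof -
  have H': "finite_group H" using finite_group_iso[OF assms] .
  have iso': "H \<cong> G" using G iso group.iso_sym by (auto simp: finite_group_def)
  have grpG: "group G" using G by (simp add: finite_group_def)
  have "order (G Mod O_p'_p p G) = order (H Mod O_p'_p p H)" if p: "prime p" for p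
  proof -
    have "card (O_p'_p p G) = card (O_p'_p p H)"
      using card_O_p'_p_le_iso[OF G H iso p] card_O_p'_p_le_iso[OF H' grpG iso' p] by simp
    moreover have "order G = order H" using iso_same_card[OF iso] by (simp add: order_def)
    moreover have "card (O_p'_p p G) > 0" using card_normal_pos[OF G normal_O_p'_p[OF G p]] .
    ultimately show ?thesis
      using finite_group_Mod_O_p'_p(2)[OF G p] finite_group_Mod_O_p'_p(2)[OF H' p] by simp
  qed
  then have "parcs (hawkes_graph G) = parcs (hawkes_graph H)"
    using in_parcs_hawkes_graph_iff[OF G] in_parcs_hawkes_graph_iff[OF H'] by auto
  moreover have "pverts (hawkes_graph G) = pverts (hawkes_graph H)"
    using group_primes_iso[OF iso] by (simp add: pverts_hawkes_graph)
  ultimately show ?thesis by (simp add: pair_pre_digraph.equality)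
qed

lemma DirProd_normal_subgroups:
  assumes "M \<lhd> A" "N \<lhd> B"
  shows "M \<times> N \<lhd> A \<times>\<times> B"
proof -
  interpret M: normal M A by fact
  interpret N: normal N B by fact
  interpret D: group "A \<times>\<times> B" using DirProd_group[OF M.is_group N.is_group] .
  have "subgroup (M \<times> N) (A \<times>\<times> B)"
    using DirProd_subgroups[OF M.is_group M.is_subgroup N.is_group N.is_subgroup] .
  moreover have "x \<otimes>\<^bsub>A \<times>\<times> B\<^esub> n \<otimes>\<^bsub>A \<times>\<times> B\<^esub> inv\<^bsub>A \<times>\<times> B\<^esub> x \<in> M \<times> N"
    if x: "x \<in> carrier (A \<times>\<times> B)" and n: "n \<in> M \<times> N" for x n
  proof -
    obtain a b m k where ab: "x = (a, b)" "n = (m, k)" by (cases x, cases n) auto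
    then show ?thesis
      using x n M.inv_op_closed2 N.inv_op_closed2 M.is_group N.is_group by simp
  qed
  ultimately show ?thesis by (simp add: D.normal_inv_iff)
qed

text \<open>
  The product of two \<open>p\<close>-nilpotent normal subgroups has the product of the complements as its normal
  \<open>p\<close>-complement; conversely, both projections map into the radicals of the factors.
\<close>

lemma O_p'_p_DirProd:
  assumes A: "finite_group A" and B: "finite_group B" and p: "prime p"
  shows "O_p'_p p (A \<times>\<times> B) = O_p'_p p A \<times> O_p'_p p B"
proof
  interpret A: group A using A by (simp add: finite_group_def)
  interpret B: group B using B by (simp add: finite_group_def)
  interpret D: group "A \<times>\<times> B" using DirProd_group[OF A.is_group B.is_group] .
  have finD: "finite (carrier (A \<times>\<times> B))" using A B by (simp add: finite_group_def)
  have D: "finite_group (A \<times>\<times> B)" using finD by (simp add: finite_group_def)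
  note OA = normal_O_p'_p[OF A p] and OB = normal_O_p'_p[OF B p]
  have OO: "O_p'_p p A \<times> O_p'_p p B \<lhd> A \<times>\<times> B" using DirProd_normal_subgroups[OF OA OB] .
  obtain M where M: "normal_p_complement p A (O_p'_p p A) M"
    using p_nilpotent_O_p'_p[OF A p] p_nilpotent_iff_normal_p_complement[OF A p OA] by auto
  obtain N where N: "normal_p_complement p B (O_p'_p p B) N"
    using p_nilpotent_O_p'_p[OF B p] p_nilpotent_iff_normal_p_complement[OF B p OB] by auto
  obtain k l where k: "card (O_p'_p p A) = card M * p ^ k" and l: "card (O_p'_p p B) = card N * p ^ l"
    using M N by (auto simp: normal_p_complement_def)
  have "card (O_p'_p p A \<times> O_p'_p p B) = card (M \<times> N) * p ^ (k + l)"
    by (simp add: card_cartesian_product k l power_add)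
  moreover have "\<not> p dvd card (M \<times> N)"
    using M N p by (simp add: normal_p_complement_def card_cartesian_product prime_dvd_mult_iff)
  moreover have "M \<times> N \<lhd> A \<times>\<times> B"
    using M N DirProd_normal_subgroups[of M A N B] by (simp add: normal_p_complement_def)
  moreover have "M \<times> N \<subseteq> O_p'_p p A \<times> O_p'_p p B"
    using M N by (intro Sigma_mono) (simp_all add: normal_p_complement_def)
  ultimately have "normal_p_complement p (A \<times>\<times> B) (O_p'_p p A \<times> O_p'_p p B) (M \<times> N)"
    unfolding normal_p_complement_def by metis
  then have "p_nilpotent p ((A \<times>\<times> B)\<lparr>carrier := O_p'_p p A \<times> O_p'_p p B\<rparr>)"
    using p_nilpotent_iff_normal_p_complement[OF D p OO] by metis
  then show "O_p'_p p A \<times> O_p'_p p B \<subseteq> O_p'_p p (A \<times>\<times> B)"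
    by (rule O_p'_p_greatest[OF D p OO])
  interpret fst: group_hom "A \<times>\<times> B" A fst
    by unfold_locales (auto simp: hom_def)
  interpret snd: group_hom "A \<times>\<times> B" B snd
    by unfold_locales (auto simp: hom_def)
  have "fst ` carrier (A \<times>\<times> B) = carrier A" "snd ` carrier (A \<times>\<times> B) = carrier B"
    using A.one_closed B.one_closed by (simp_all, (metis emptyE)+)
  then have img: "fst ` O_p'_p p (A \<times>\<times> B) \<subseteq> O_p'_p p A" "snd ` O_p'_p p (A \<times>\<times> B) \<subseteq> O_p'_p p B"
    using fst.O_p'_p_image[OF _ finD p] snd.O_p'_p_image[OF _ finD p] by simp_all
  show "O_p'_p p (A \<times>\<times> B) \<subseteq> O_p'_p p A \<times> O_p'_p p B"
  proof
    fix x assume "x \<in> O_p'_p p (A \<times>\<times> B)"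
    then have "fst x \<in> O_p'_p p A" "snd x \<in> O_p'_p p B"
      using subsetD[OF img(1) imageI] subsetD[OF img(2) imageI] by simp_all
    then show "x \<in> O_p'_p p A \<times> O_p'_p p B" by (simp add: mem_Times_iff)
  qed
qed

lemma hawkes_graph_DirProd:
  assumes A: "finite_group A" and B: "finite_group B"
  shows "pverts (hawkes_graph (A \<times>\<times> B)) = pverts (hawkes_graph A) \<union> pverts (hawkes_graph B)"
    and "parcs (hawkes_graph (A \<times>\<times> B)) = parcs (hawkes_graph A) \<union> parcs (hawkes_graph B)"
proof -
  have grp: "group A" "group B" using A B by (simp_all add: finite_group_def)
  have D: "finite_group (A \<times>\<times> B)"
    using A B DirProd_group[OF grp] by (simp add: finite_group_def)
  have oD: "order (A \<times>\<times> B) = order A * order B" by (simp add: order_def card_cartesian_product)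
  show "pverts (hawkes_graph (A \<times>\<times> B)) = pverts (hawkes_graph A) \<union> pverts (hawkes_graph B)"
    using A B D by (auto simp: pverts_hawkes_graph in_group_primes_iff oD prime_dvd_mult_iff)
  have "order ((A \<times>\<times> B) Mod O_p'_p p (A \<times>\<times> B)) =
      order (A Mod O_p'_p p A) * order (B Mod O_p'_p p B)" if p: "prime p" for p
  proof -
    let ?a = "card (O_p'_p p A)" and ?b = "card (O_p'_p p B)"
    have "order ((A \<times>\<times> B) Mod O_p'_p p (A \<times>\<times> B)) * (?a * ?b) = order A * order B"
      using finite_group_Mod_O_p'_p(2)[OF D p] oD
      by (simp add: O_p'_p_DirProd[OF A B p] card_cartesian_product)
    also have "\<dots> = order (A Mod O_p'_p p A) * order (B Mod O_p'_p p B) * (?a * ?b)"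
      using finite_group_Mod_O_p'_p(2)[OF A p] finite_group_Mod_O_p'_p(2)[OF B p]
      by (simp add: mult_ac)
    finally show ?thesis
      using card_normal_pos[OF A normal_O_p'_p[OF A p]] card_normal_pos[OF B normal_O_p'_p[OF B p]]
      by simp
  qed
  then show "parcs (hawkes_graph (A \<times>\<times> B)) = parcs (hawkes_graph A) \<union> parcs (hawkes_graph B)"
    using A B D by (auto simp: in_parcs_hawkes_graph_iff prime_dvd_mult_iff)
qed

section \<open>Local formations defined by sets of primes\<close>

text \<open>
  As \<open>O_p'_p p G\<close> is the intersection of the centralizers of the \<open>p\<close>-chief factors, a prime divides the
  order of its quotient if and only if it divides the order of the group induced on some
  \<open>p\<close>-chief factor.
\<close>

lemma LF_pi_groups_iff:
  fixes G (structure)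
  assumes f: "\<And>p. f p = (if p \<in> P then pi_groups (\<sigma> p) else {})"
  shows "G \<in> LF f \<longleftrightarrow> finite_group G \<and> group_primes G \<subseteq> P \<and>
    (\<forall>p\<in>group_primes G. group_primes (G Mod O_p'_p p G) \<subseteq> \<sigma> p)" (is "_ \<longleftrightarrow> ?R")
proof
  assume GL: "G \<in> LF f"
  then have G: "finite_group G" by (simp add: LF_def)
  interpret group G using G by (simp add: finite_group_def)
  have local: "p \<in> P \<and> group_primes (G Mod centralizer_factor G H K) \<subseteq> \<sigma> p"
    if chief: "chief_factor G H K" and p: "prime p" "p dvd order (G\<lparr>carrier := H\<rparr> Mod K)" for H K p
  proof -
    have "finite_group (G\<lparr>carrier := H\<rparr> Mod K)"
      using finite_group_Mod_restrict(1)[OF G] chief by (simp add: chief_factor_def psubset_eq)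
    then have "p \<in> group_primes (G\<lparr>carrier := H\<rparr> Mod K)" using p by (simp add: in_group_primes_iff)
    then obtain Y where Y: "Y \<in> f p" "Y \<cong> G Mod centralizer_factor G H K"
      using GL chief unfolding LF_def in_class_def by blast
    then show ?thesis
      using group_primes_iso[OF Y(2)] f by (auto simp: pi_groups_def split: if_splits)
  qed
  have "p \<in> P" if "p \<in> group_primes G" for p
    using exists_chief_factor_of_prime[OF G] local that in_group_primes_iff[OF G] by metis
  moreover have "q \<in> \<sigma> p"
    if p: "p \<in> group_primes G" and q: "q \<in> group_primes (G Mod O_p'_p p G)" for p q
  proof -
    have pp: "prime p" using p in_group_primes_iff[OF G] by simp
    have q': "prime q" "q dvd order (G Mod O_p'_p p G)"
      using q in_group_primes_iff[OF finite_group_Mod_O_p'_p(1)[OF G pp]] by simp_all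
    have "N \<subseteq> carrier G" if "N \<in> p_chief_centralizers p G" for N
      using normal_p_chief_centralizers[OF that] normal_imp_subgroup subgroup.subset by metis
    then have fin: "finite (p_chief_centralizers p G)"
      using G finite_subset[of "p_chief_centralizers p G" "Pow (carrier G)"]
      by (auto simp: finite_group_def)
    have nonempty: "p_chief_centralizers p G \<noteq> {}" by (simp add: p_chief_centralizers_def)
    obtain N where N: "N \<in> p_chief_centralizers p G" "q dvd order (G Mod N)"
      using prime_dvd_order_Mod_Inter[OF G q'(1) fin nonempty normal_p_chief_centralizers[of _ p]] q'(2)
      unfolding O_p'_p_eq_Inter[OF G pp] by auto
    have NG: "N \<lhd> G" using normal_p_chief_centralizers[OF N(1)] .
    have "N \<noteq> carrier G"
    proof
      assume "N = carrier G"
      then have "order G = order (G Mod N) * order G"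
        using finite_group_Mod(2)[OF G NG] by (simp add: order_def)
      moreover have "order G > 0" using order_gt_0_iff_finite G by (simp add: finite_group_def)
      ultimately have "order (G Mod N) = 1" by simp
      then show False using N(2) q'(1) not_prime_unit by metis
    qed
    then obtain H K where HK: "N = centralizer_factor G H K" "chief_factor G H K"
        "p dvd order (G\<lparr>carrier := H\<rparr> Mod K)"
      using N(1) by (auto simp: p_chief_centralizers_def)
    have "q \<in> group_primes (G Mod N)"
      using finite_group_Mod(1)[OF G NG] N(2) q'(1) by (simp add: in_group_primes_iff)
    then show ?thesis using local[OF HK(2) pp HK(3)] HK(1) by auto
  qed
  ultimately show ?R using G by auto
next
  assume R: ?R
  then have G: "finite_group G" by simp
  interpret group G using G by (simp add: finite_group_def)
  have "in_class (G Mod centralizer_factor G H K) (f p)"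
    if chief: "chief_factor G H K" and p: "p \<in> group_primes (G\<lparr>carrier := H\<rparr> Mod K)" for H K p
  proof -
    let ?C = "centralizer_factor G H K"
    have HK: "H \<lhd> G" "K \<lhd> G" "K \<subseteq> H" using chief by (auto simp: chief_factor_def)
    have p': "prime p" "p dvd order (G\<lparr>carrier := H\<rparr> Mod K)"
      using p in_group_primes_iff[OF finite_group_Mod_restrict(1)[OF G HK]] by simp_all
    have "card H dvd order G"
      using card_subgroup_dvd[OF normal_imp_subgroup[OF HK(1)] subgroup_self]
        subgroup.subset[OF normal_imp_subgroup[OF HK(1)]] by (simp add: order_def)
    then have "p dvd order G"
      using p'(2) order_chief_factor[OF G chief] by (metis dvd_mult dvd_trans)
    then have pG: "p \<in> group_primes G" using p'(1) in_group_primes_iff[OF G] by simp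
    have C: "?C \<lhd> G" using normal_centralizer_factor[OF HK(1,2)] .
    have "O_p'_p p G \<subseteq> ?C"
      using p_nilpotent_subset_centralizer_factor[OF G p'(1) chief p'(2)
          normal_O_p'_p[OF G p'(1)] p_nilpotent_O_p'_p[OF G p'(1)]] .
    then have "order (G Mod ?C) dvd order (G Mod O_p'_p p G)"
      using order_Mod_antimono[OF G normal_O_p'_p[OF G p'(1)] C] by simp
    then have "group_primes (G Mod ?C) \<subseteq> \<sigma> p"
      using group_primes_subset[OF finite_group_Mod(1)[OF G C] finite_group_Mod_O_p'_p(1)[OF G p'(1)]]
        R pG by auto
    moreover obtain Y :: "nat monoid" where Y: "finite_group Y" "G Mod ?C \<cong> Y"
      using ex_nat_group[OF finite_group_Mod(1)[OF G C]] by auto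
    ultimately have "Y \<in> f p"
      using R pG f group_primes_iso[OF Y(2)] by (auto simp: pi_groups_def)
    moreover have "Y \<cong> G Mod ?C"
      using group.iso_sym[OF _ Y(2)] finite_group_Mod(1)[OF G C] by (simp add: finite_group_def)
    ultimately show ?thesis unfolding in_class_def by auto
  qed
  then show "G \<in> LF f" using G by (simp add: LF_def)
qed

section \<open>Formations recognized by the Hawkes graph\<close>

lemma in_class_Mod_kernel:
  assumes h: "group_hom G H h" "h ` carrier G = carrier H" and H: "H \<in> \<FF>"
  shows "in_class (G Mod kernel G H h) \<FF>"
proof -
  interpret group_hom G H h by fact
  have "group (G Mod kernel G H h)" using normal.factorgroup_is_group[OF normal_kernel] .
  moreover have "G Mod kernel G H h \<cong> H" using FactGroup_iso[OF h(2)] .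
  ultimately have "H \<cong> G Mod kernel G H h" by (rule group.iso_sym)
  then show ?thesis using H by (auto simp: in_class_def)
qed

text \<open>
  A class contains only groups carried by \<^typ>\<open>nat\<close>, so the direct product enters through an
  isomorphic copy together with its two projections.
\<close>

lemma nat_copy_of_DirProd:
  fixes A B :: "nat monoid"
  assumes "finite_group A" "finite_group B"
  obtains D :: "nat monoid" and \<pi>\<^sub>1 \<pi>\<^sub>2 where "finite_group D"
    "hawkes_graph D = hawkes_graph (A \<times>\<times> B)"
    "group_hom D A \<pi>\<^sub>1" "\<pi>\<^sub>1 ` carrier D = carrier A"
    "group_hom D B \<pi>\<^sub>2" "\<pi>\<^sub>2 ` carrier D = carrier B"
    "kernel D A \<pi>\<^sub>1 \<inter> kernel D B \<pi>\<^sub>2 = {\<one>\<^bsub>D\<^esub>}"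
proof -
  interpret A: group A using assms(1) by (simp add: finite_group_def)
  interpret B: group B using assms(2) by (simp add: finite_group_def)
  interpret AB: group "A \<times>\<times> B" using DirProd_group[OF A.is_group B.is_group] .
  have finAB: "finite_group (A \<times>\<times> B)"
    using assms AB.is_group by (simp add: finite_group_def)
  obtain D :: "nat monoid" where D: "finite_group D" "A \<times>\<times> B \<cong> D"
    using ex_nat_group[OF finAB] by auto
  interpret D: group D using D(1) by (simp add: finite_group_def)
  have graph: "hawkes_graph D = hawkes_graph (A \<times>\<times> B)"
    using hawkes_graph_iso[OF finAB D.is_group D(2)] by simp
  obtain i where i: "i \<in> iso D (A \<times>\<times> B)"
    using AB.iso_sym[OF D(2)] by (auto simp: is_iso_def)
  have ihom: "i \<in> hom D (A \<times>\<times> B)" and bij: "bij_betw i (carrier D) (carrier A \<times> carrier B)"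
    using i by (auto simp: iso_def)
  interpret i: group_hom D "A \<times>\<times> B" i
    using ihom by unfold_locales
  have \<pi>: "group_hom D A (fst \<circ> i)" "group_hom D B (snd \<circ> i)"
    using ihom hom_pairwise[of i D A B] A.is_group B.is_group D.is_group
    by (simp_all add: group_hom_def group_hom_axioms_def)
  have img: "i ` carrier D = carrier A \<times> carrier B" using bij by (simp add: bij_betw_def)
  have surj: "(fst \<circ> i) ` carrier D = carrier A" "(snd \<circ> i) ` carrier D = carrier B"
    unfolding image_comp[symmetric] img using A.carrier_not_empty B.carrier_not_empty by simp_all
  have "x = \<one>\<^bsub>D\<^esub>" if "x \<in> carrier D" "fst (i x) = \<one>\<^bsub>A\<^esub>" "snd (i x) = \<one>\<^bsub>B\<^esub>" for x
  proof -
    have "i x = i \<one>\<^bsub>D\<^esub>" using that(2,3) i.hom_one by (simp add: prod_eq_iff)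
    then show ?thesis
      using bij that(1) D.one_closed by (metis bij_betw_def inj_onD)
  qed
  then have "kernel D A (fst \<circ> i) \<inter> kernel D B (snd \<circ> i) = {\<one>\<^bsub>D\<^esub>}"
    using group_hom.hom_one[OF \<pi>(1)] group_hom.hom_one[OF \<pi>(2)] by (auto simp: kernel_def)
  then show ?thesis by (rule that[OF D(1) graph \<pi>(1) surj(1) \<pi>(2) surj(2)])
qed

lemma finite_group_of_formation:
  assumes "formation \<FF>" "G \<in> \<FF>"
  shows "finite_group G"
proof -
  have "is_group_class \<FF>" using assms(1) unfolding formation_def by (rule conjunct1)
  then have "\<forall>G\<in>\<FF>. finite_group G" unfolding is_group_class_def by (rule conjunct1)
  then show ?thesis using assms(2) by (rule bspec)
qed

text \<open>
  The kernels of the two projections intersect trivially and have quotients in the formation.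
\<close>

lemma formation_contains_DirProd_graph:
  assumes F: "formation \<FF>" and A: "A \<in> \<FF>" and B: "B \<in> \<FF>"
  obtains D where "D \<in> \<FF>" "hawkes_graph D = hawkes_graph (A \<times>\<times> B)"
proof -
  note fin = finite_group_of_formation[OF F]
  obtain D :: "nat monoid" and \<pi>\<^sub>1 \<pi>\<^sub>2 where D: "finite_group D"
    "hawkes_graph D = hawkes_graph (A \<times>\<times> B)"
    "group_hom D A \<pi>\<^sub>1" "\<pi>\<^sub>1 ` carrier D = carrier A"
    "group_hom D B \<pi>\<^sub>2" "\<pi>\<^sub>2 ` carrier D = carrier B"
    and ker: "kernel D A \<pi>\<^sub>1 \<inter> kernel D B \<pi>\<^sub>2 = {\<one>\<^bsub>D\<^esub>}"
    by (rule nat_copy_of_DirProd[OF fin[OF A] fin[OF B]])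
  let ?\<N> = "{kernel D A \<pi>\<^sub>1, kernel D B \<pi>\<^sub>2}"
  have "N \<lhd> D \<and> in_class (D Mod N) \<FF>" if "N \<in> ?\<N>" for N
    using that group_hom.normal_kernel[OF D(3)] group_hom.normal_kernel[OF D(5)]
      in_class_Mod_kernel[OF D(3,4) A] in_class_Mod_kernel[OF D(5,6) B] by auto
  moreover have "\<Inter>?\<N> = {\<one>\<^bsub>D\<^esub>}" using ker by simp
  moreover have "finite ?\<N>" "?\<N> \<noteq> {}" by simp_all
  ultimately have "D \<in> \<FF>" using F D(1) unfolding formation_def by metis
  then show ?thesis using D(2) by (rule that)
qed

lemma formation_hawkes_graph_upper_bound:
  assumes F: "formation \<FF>" "\<FF> \<noteq> {}" and S: "finite \<S>" "\<S> \<subseteq> \<FF>"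
  shows "\<exists>D\<in>\<FF>. \<forall>A\<in>\<S>. pverts (hawkes_graph A) \<subseteq> pverts (hawkes_graph D) \<and>
    parcs (hawkes_graph A) \<subseteq> parcs (hawkes_graph D)"
  using S
proof (induction \<S> rule: finite_induct)
  case empty
  then show ?case using F(2) by auto
next
  case (insert A \<S>)
  then obtain B where B: "B \<in> \<FF>" "\<forall>A\<in>\<S>. pverts (hawkes_graph A) \<subseteq> pverts (hawkes_graph B) \<and>
      parcs (hawkes_graph A) \<subseteq> parcs (hawkes_graph B)" by auto
  have A: "A \<in> \<FF>" using insert.prems by simp
  obtain D where D: "D \<in> \<FF>" "hawkes_graph D = hawkes_graph (A \<times>\<times> B)"
    by (rule formation_contains_DirProd_graph[OF F(1) A B(1)])
  note union = hawkes_graph_DirProd[OF finite_group_of_formation[OF F(1) A]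
      finite_group_of_formation[OF F(1) B(1)], folded D(2)]
  have "pverts (hawkes_graph C) \<subseteq> pverts (hawkes_graph D) \<and>
      parcs (hawkes_graph C) \<subseteq> parcs (hawkes_graph D)" if "C \<in> insert A \<S>" for C
    using that B(2) unfolding union by auto
  then show ?case using D(1) by auto
qed

lemma finite_hawkes_graph: "finite (pverts (hawkes_graph G))" "finite (parcs (hawkes_graph G))"
proof -
  show *: "finite (pverts (hawkes_graph G))" by (simp add: pverts_hawkes_graph group_primes_def)
  have "parcs (hawkes_graph G) \<subseteq> pverts (hawkes_graph G) \<times> pverts (hawkes_graph G)"
    by (auto simp: hawkes_graph_def)
  then show "finite (parcs (hawkes_graph G))" using * by (meson finite_SigmaI finite_subset)
qed

text \<open>
  The condition on \<open>G\<close> in \<open>LF_pi_groups_iff\<close> says precisely that the vertices and the edges of its graph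
  occur in the graph of the class.
\<close>

lemma in_LF_iff_hawkes_graph_subset:
  assumes \<sigma>: "\<And>p. \<sigma> p = {q. (p, q) \<in> parcs (class_hawkes_graph \<FF>)}"
    and f: "\<And>p. f p = (if p \<in> class_primes \<FF> then pi_groups (\<sigma> p) else {})"
  shows "G \<in> LF f \<longleftrightarrow> finite_group G \<and>
    pverts (hawkes_graph G) \<subseteq> pverts (class_hawkes_graph \<FF>) \<and>
    parcs (hawkes_graph G) \<subseteq> parcs (class_hawkes_graph \<FF>)"
proof (cases "finite_group G")
  case G: True
  have verts: "pverts (class_hawkes_graph \<FF>) = class_primes \<FF>"
    by (simp add: class_hawkes_graph_def class_primes_def pverts_hawkes_graph)
  have arcs: "(p, q) \<in> parcs (hawkes_graph G) \<longleftrightarrow>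
      p \<in> group_primes G \<and> q \<in> group_primes (G Mod O_p'_p p G)" for p q
  proof (cases "prime p")
    case True
    have "p \<in> group_primes G" if "(p, q) \<in> parcs (hawkes_graph G)"
      using that by (simp add: hawkes_graph_def)
    then show ?thesis
      using True in_parcs_hawkes_graph_iff[OF G, of p q]
        in_group_primes_iff[OF finite_group_Mod_O_p'_p(1)[OF G True], of q] by auto
  next
    case False
    then show ?thesis by (simp add: in_parcs_hawkes_graph_iff[OF G] in_group_primes_iff[OF G])
  qed
  have "parcs (hawkes_graph G) \<subseteq> parcs (class_hawkes_graph \<FF>) \<longleftrightarrow>
      (\<forall>p\<in>group_primes G. group_primes (G Mod O_p'_p p G) \<subseteq> \<sigma> p)"
    by (auto simp: arcs \<sigma> subset_iff)
  then show ?thesis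
    using G LF_pi_groups_iff[OF f] by (simp add: verts pverts_hawkes_graph)
qed (simp add: LF_def)

text \<open>
  Choosing a member of \<open>\<FF>\<close> for each vertex and each edge of the graph of \<open>G\<close>, and an upper bound \<open>A\<close> for
  these finitely many members, gives a group in \<open>\<FF>\<close> whose graph does not change when it is
  multiplied by \<open>G\<close>.
\<close>

lemma recognized_formation_contains_subgraph_groups:
  assumes F: "formation \<FF>" "\<FF> \<noteq> {}" and rec: "recognized_by \<FF> hawkes_graph"
    and G: "finite_group G" "pverts (hawkes_graph G) \<subseteq> pverts (class_hawkes_graph \<FF>)"
      "parcs (hawkes_graph G) \<subseteq> parcs (class_hawkes_graph \<FF>)"
  shows "G \<in> \<FF>"
proof -
  have "\<forall>v\<in>pverts (hawkes_graph G). \<exists>A\<in>\<FF>. v \<in> pverts (hawkes_graph A)"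
    using G(2) by (auto simp: class_hawkes_graph_def)
  then obtain g where g: "\<forall>v\<in>pverts (hawkes_graph G). g v \<in> \<FF> \<and> v \<in> pverts (hawkes_graph (g v))"
    by metis
  have "\<forall>e\<in>parcs (hawkes_graph G). \<exists>A\<in>\<FF>. e \<in> parcs (hawkes_graph A)"
    using G(3) by (auto simp: class_hawkes_graph_def)
  then obtain h where h: "\<forall>e\<in>parcs (hawkes_graph G). h e \<in> \<FF> \<and> e \<in> parcs (hawkes_graph (h e))"
    by metis
  let ?\<S> = "g ` pverts (hawkes_graph G) \<union> h ` parcs (hawkes_graph G)"
  have "finite ?\<S>" "?\<S> \<subseteq> \<FF>" using finite_hawkes_graph g h by auto
  then obtain A where A: "A \<in> \<FF>" and ub: "\<forall>C\<in>?\<S>. pverts (hawkes_graph C) \<subseteq> pverts (hawkes_graph A) \<and>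
      parcs (hawkes_graph C) \<subseteq> parcs (hawkes_graph A)"
    using formation_hawkes_graph_upper_bound[OF F, of ?\<S>] by auto
  have "v \<in> pverts (hawkes_graph A)" if "v \<in> pverts (hawkes_graph G)" for v
    using bspec[OF ub, of "g v"] bspec[OF g that] that by auto
  moreover have "e \<in> parcs (hawkes_graph A)" if "e \<in> parcs (hawkes_graph G)" for e
    using bspec[OF ub, of "h e"] bspec[OF h that] that by auto
  ultimately have sub: "pverts (hawkes_graph G) \<subseteq> pverts (hawkes_graph A)"
      "parcs (hawkes_graph G) \<subseteq> parcs (hawkes_graph A)"
    by blast+
  have finA: "finite_group A" using finite_group_of_formation[OF F(1) A] .
  obtain D :: "nat monoid" and \<pi>\<^sub>1 \<pi>\<^sub>2 where D: "finite_group D"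
    "hawkes_graph D = hawkes_graph (A \<times>\<times> G)"
    "group_hom D A \<pi>\<^sub>1" "\<pi>\<^sub>1 ` carrier D = carrier A"
    "group_hom D G \<pi>\<^sub>2" "\<pi>\<^sub>2 ` carrier D = carrier G"
    "kernel D A \<pi>\<^sub>1 \<inter> kernel D G \<pi>\<^sub>2 = {\<one>\<^bsub>D\<^esub>}"
    by (rule nat_copy_of_DirProd[OF finA G(1)])
  have "hawkes_graph A = hawkes_graph D"
    using hawkes_graph_DirProd[OF finA G(1), folded D(2)] sub
    by (intro pair_pre_digraph.equality) auto
  then have "D \<in> \<FF>" using rec finA D(1) A unfolding recognized_by_def by metis
  moreover have "\<pi>\<^sub>2 \<in> epi D G"
    using D(5,6) by (simp add: epi_def group_hom_def group_hom_axioms_def)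
  moreover have "group G" using G(1) by (simp add: finite_group_def)
  ultimately show ?thesis using F(1) unfolding formation_def by (metis empty_iff)
qed

theorem theorem4p3:
  fixes \<FF> :: group_class
    and \<sigma> :: "nat \<Rightarrow> nat set"
    and f :: "nat \<Rightarrow> group_class"
  assumes "formation \<FF>"
    and "\<FF> \<noteq> {}"
    and "\<And>p. \<sigma> p = {q. (p, q) \<in> parcs (class_hawkes_graph \<FF>)}"
    and "\<And>p. f p = (if p \<in> class_primes \<FF> then pi_groups (\<sigma> p) else {})"
  shows "recognized_by \<FF> hawkes_graph \<longleftrightarrow> \<FF> = LF f"
proof
  note LF = in_LF_iff_hawkes_graph_subset[OF assms(3,4)]
  have "\<FF> \<subseteq> LF f"
    using finite_group_of_formation[OF assms(1)] by (auto simp: LF class_hawkes_graph_def)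
  moreover assume "recognized_by \<FF> hawkes_graph"
  then have "LF f \<subseteq> \<FF>"
    using recognized_formation_contains_subgraph_groups[OF assms(1,2)] LF by auto
  ultimately show "\<FF> = LF f" by auto
next
  note LF = in_LF_iff_hawkes_graph_subset[OF assms(3,4)]
  assume "\<FF> = LF f"
  then show "recognized_by \<FF> hawkes_graph"
    unfolding recognized_by_def using LF by metis
qed

end
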